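(* Let $n\ge 2$ and $r\ge 1$. If $\mathrm{Z}:\mathcal{P}(\mathbb{Z}^n)\to\mathbb{T}^r$ is a translation covariant valuation, then $$\mathrm{Z}(\operatorname{relint}P)=(-1)^{\dim(P)}\sum_{i=0}^{n+r}(-1)^i\,\mathrm{Z}_i(-P)$$ for $P\in\mathcal{P}(\mathbb{Z}^n)$, where $\mathrm{Z}_0,\dots,\mathrm{Z}_{n+r}$ are the homogeneous components of $\mathrm{Z}$.
   Context: $\mathbb{N}$ is the set of non-negative integers. $\mathcal{P}(\mathbb{Z}^n)$ is the set of lattice polytopes in $\mathbb{R}^n$, i.e. convex polytopes with vertices in $\mathbb{Z}^n$ (the empty set is included, with the convention $\dim\emptyset=-1$). $\mathbb{T}^r$ is the vector space of symmetric tensors of rank $r$ on $\mathbb{R}^n$, identified via the scalar product with symmetric $r$-linear functionals on $(\mathbb{R}^n)^r$; $\mathbb{T}^0=\mathbb{R}$. For $x\in\mathbb{R}^n$, $x^r\in\mathbb{T}^r$ is the $r$-fold symmetric tensor product, $x^r(v_1,\dots,v_r)=(x\cdot v_1)\cdots(x\cdot v_r)$, and $x^0=1$. Products of symmetric tensors are symmetric tensor products: for $A\in\mathbb{T}^{p}$, $B\in\mathbb{T}^{q}$, $(AB)(v_1,\dots,v_{p+q})=\frac{1}{(p+q)!}\sum_\sigma A(v_{\sigma(1)},\dots,v_{\sigma(p)})B(v_{\sigma(p+1)},\dots,v_{\sigma(p+q)})$, summing over all permutations $\sigma$ of $1,\dots,p+q$. A function $\mathrm{Z}:\mathcal{P}(\mathbb{Z}^n)\to\mathbb{T}^r$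 is a valuation if $\mathrm{Z}(\emptyset)=0$ and $\mathrm{Z}(P)+\mathrm{Z}(Q)=\mathrm{Z}(P\cup Q)+\mathrm{Z}(P\cap Q)$ whenever $P,Q,P\cup Q,P\cap Q\in\mathcal{P}(\mathbb{Z}^n)$. A valuation $\mathrm{Z}$ is translation covariant if there are functions $\mathrm{Z}^j:\mathcal{P}(\mathbb{Z}^n)\to\mathbb{T}^j$, $j=0,\dots,r$, such that $\mathrm{Z}(P+y)=\sum_{j=0}^r\mathrm{Z}^{r-j}(P)\frac{y^j}{j!}$ for all $y\in\mathbb{Z}^n$ and $P\in\mathcal{P}(\mathbb{Z}^n)$. For a translation covariant valuation $\mathrm{Z}$, its homogeneous components $\mathrm{Z}_i:\mathcal{P}(\mathbb{Z}^n)\to\mathbb{T}^r$, $i=0,\dots,n+r$, are the coefficients (which exist and are unique) in $\mathrm{Z}(kP)=\sum_{i=0}^{n+r}\mathrm{Z}_i(P)k^i$ for all $k\in\mathbb{N}$, $P\in\mathcal{P}(\mathbb{Z}^n)$. A valuation $\mathrm{Z}$ on $\mathcal{P}(\mathbb{Z}^n)$ extends (McMullen) to finite unions of lattice polytopes so that $\mathrm{Z}(P_1\cup\dots\cup P_m)=\sum_{\emptyset\ne J\subset\{1,\dots,m\}}(-1)^{|J|-1}\mathrm{Z}\big(\bigcap_{j\in J}P_j\big)$ whenever all the intersections are lattice polytopes. One sets $\mathrm{Z}(\operatorname{relint}P)=\mathrm{Z}(P)-\mathrm{Z}(\operatorname{relbd}P)$, where $\operatorname{relbd}P$ is the relative boundary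 of $P$, the union of its proper faces; equivalently $\mathrm{Z}(\operatorname{relint}P)=(-1)^{\dim(P)}\sum_F(-1)^{\dim(F)}\mathrm{Z}(F)$, summing over all non-empty faces $F$ of $P$ (including $P$). $-P=\{-x:x\in P\}$. *)

theory Defs
  imports "HOL-Analysis.Analysis"
begin

text \<open>
  Tensors of all ranks share one type, so that ranks can be summed over: a rank \<open>r\<close> tensor is a
  functional on sequences of vectors that only reads the entries \<open>0, \<dots>, r - 1\<close>. In particular rank
  \<open>0\<close> tensors are the constant functionals, and equality of tensors is equality of functions.
\<close>

type_synonym 'n tensor = "(nat \<Rightarrow> real ^ 'n) \<Rightarrow> real"

definition sym_tensors :: "nat \<Rightarrow> ('n::finite) tensor set" where
  "sym_tensors r = {A.
     (\<forall>v w. (\<forall>i<r. v i = w i) \<longrightarrow> A v = A w) \<and>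
     (\<forall>i<r. \<forall>v. linear (\<lambda>x. A (v(i := x)))) \<and>
     (\<forall>\<sigma> v. \<sigma> permutes {..<r} \<longrightarrow> A (\<lambda>i. v (\<sigma> i)) = A v)}"

definition sym_power :: "nat \<Rightarrow> real ^ 'n::finite \<Rightarrow> 'n tensor" where
  "sym_power r x = (\<lambda>v. \<Prod>i<r. x \<bullet> v i)"

definition sym_prod :: "nat \<Rightarrow> nat \<Rightarrow> 'n tensor \<Rightarrow> 'n tensor \<Rightarrow> ('n::finite) tensor" where
  "sym_prod p q A B =
     (\<lambda>v. (\<Sum>\<sigma> | \<sigma> permutes {..<p + q}. A (\<lambda>i. v (\<sigma> i)) * B (\<lambda>i. v (\<sigma> (p + i)))) / fact (p + q))"

definition int_lattice :: "(real ^ 'n::finite) set" where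
  "int_lattice = {x. \<forall>i. x $ i \<in> \<int>}"

definition lattice_polytopes :: "(real ^ 'n::finite) set set" where
  "lattice_polytopes = {P. polytope P \<and> {x. x extreme_point_of P} \<subseteq> int_lattice}"

definition valuation :: "nat \<Rightarrow> ((real ^ 'n::finite) set \<Rightarrow> 'n tensor) \<Rightarrow> bool" where
  "valuation r Z \<longleftrightarrow>
     (\<forall>P\<in>lattice_polytopes. Z P \<in> sym_tensors r) \<and>
     Z {} = (\<lambda>v. 0) \<and>
     (\<forall>P\<in>lattice_polytopes. \<forall>Q\<in>lattice_polytopes.
        P \<union> Q \<in> lattice_polytopes \<longrightarrow> P \<inter> Q \<in> lattice_polytopes \<longrightarrow>
        (\<forall>v. Z P v + Z Q v = Z (P \<union> Q) v + Z (P \<inter> Q) v))"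

definition translation_covariant :: "nat \<Rightarrow> ((real ^ 'n::finite) set \<Rightarrow> 'n tensor) \<Rightarrow> bool" where
  "translation_covariant r Z \<longleftrightarrow>
     (\<exists>Z'. (\<forall>j\<le>r. \<forall>P\<in>lattice_polytopes. Z' j P \<in> sym_tensors j) \<and>
       (\<forall>P\<in>lattice_polytopes. \<forall>y\<in>int_lattice. \<forall>v.
          Z ((\<lambda>x. x + y) ` P) v =
            (\<Sum>j\<le>r. sym_prod (r - j) j (Z' (r - j) P) (sym_power j y) v / fact j)))"

text \<open>
  The coefficient sequence is padded with zero tensors beyond \<open>n + r\<close> to make it unique as a
  function on all of \<open>nat\<close>. For \<open>k = 0\<close> the dilate of a non-empty set is \<open>{0}\<close>, that of \<open>{}\<close> is \<open>{}\<close>.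
\<close>

definition homogeneous_component ::
  "nat \<Rightarrow> ((real ^ 'n::finite) set \<Rightarrow> 'n tensor) \<Rightarrow> nat \<Rightarrow> (real ^ 'n) set \<Rightarrow> 'n tensor" where
  "homogeneous_component r Z i P =
     (THE c. (\<forall>i. c i \<in> sym_tensors r) \<and>
             (\<forall>i > CARD('n) + r. c i = (\<lambda>v. 0)) \<and>
             (\<forall>(k::nat) v. Z ((\<lambda>x. real k *\<^sub>R x) ` P) v =
                (\<Sum>i\<le>CARD('n) + r. c i v * real k ^ i))) i"

text \<open>
  \<open>val_Union Z \<F>\<close> is the value on \<open>\<Union>\<F>\<close> of the extension of \<open>Z\<close> to finite unions, expressed by
  inclusion-exclusion; it is meant for finite \<open>\<F>\<close> all of whose intersections are lattice polytopes.
  This applies to the proper faces of a lattice polytope, whose union is the relative boundary.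
\<close>

definition val_Union ::
  "((real ^ 'n::finite) set \<Rightarrow> 'n tensor) \<Rightarrow> (real ^ 'n) set set \<Rightarrow> 'n tensor" where
  "val_Union Z \<F> = (\<lambda>v. \<Sum>J | J \<subseteq> \<F> \<and> J \<noteq> {}. (-1) ^ (card J - 1) * Z (\<Inter>J) v)"

definition val_relint ::
  "((real ^ 'n::finite) set \<Rightarrow> 'n tensor) \<Rightarrow> (real ^ 'n) set \<Rightarrow> 'n tensor" where
  "val_relint Z P = (\<lambda>v. Z P v - val_Union Z {F. F face_of P \<and> F \<noteq> P} v)"

end

(*
  Fix the arguments of the tensors, so that Z becomes a real-valued function f that satisfies the
  valuation identity whenever both polytopes, their union and their intersection are lattice
  polytopes. Two facts about such f are needed. (1) f is determined by its values on lattice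
  simplices: if the vertices of P are affinely dependent, a Radon partition with integer
  coefficients yields a linear relation between f(P) and the values of f on hulls of fewer
  vertices. (2) P |-> f*(P) := sum over nonempty faces F of (-1)^dim F f(F) is again a valuation.

  Dissecting (k+1)T for a simplex T gives a recursion which shows that f(kT) is a polynomial in k,
  and evaluating the recursion at k = -1 identifies the value at k = -1 of f(k(-T)) with f*(T). By
  (1) and (2) both statements extend to all lattice polytopes P. Applied to -kP this yields
  f(P) = sum over F of h(F), where h(F) = (-1)^dim F times the value of f(k(-F)) at k = -1, and
  inclusion-exclusion over the proper faces leaves h(P) = f(relint P).
*)
theory Submission imports Defs begin

subsection \<open>Lattice polytopes and valuations\<close>

text \<open>The obstacle is that the valuation identity is available only for two lattice polytopes
  whose union and intersection are again lattice polytopes, while a hyperplane usually cuts a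
  lattice polytope into pieces with non-integral vertices. Cuts are therefore made only where all
  four polytopes are visibly hulls of lattice points: the hulls of point sets A and B are separated
  by the hull of C in the sense that every segment from one to the other passes through it at one
  fixed ratio. The ratio k/(k+1) gives the dissection of dilates, 1/2 the cuts of difference bodies,
  and 1/\<Lambda> the two-point relation behind Radon partitions.

  Covariance enters only as a bound on the order of f under translations: differences of order r+1
  vanish. The order drops when a translate of kT is compared with kT, which makes the recursion
  terminate. Polynomiality (an iterated forward difference in k vanishes) and reciprocity (a
  difference of two valuations vanishes) both have the form g = 0 for a valuation g, the form in
  which the reduction to simplices applies.\<close>

lemma int_lattice_add: "x \<in> int_lattice \<Longrightarrow> y \<in> int_lattice \<Longrightarrow> x + y \<in> int_lattice"
  by (simp add: int_lattice_def)

lemma int_lattice_uminus: "x \<in> int_lattice \<Longrightarrow> - x \<in> int_lattice"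
  by (simp add: int_lattice_def)

lemma int_lattice_diff: "x \<in> int_lattice \<Longrightarrow> y \<in> int_lattice \<Longrightarrow> x - y \<in> int_lattice"
  by (simp add: int_lattice_def)

lemma int_lattice_zero: "0 \<in> int_lattice"
  by (simp add: int_lattice_def)

lemma int_lattice_scale: "c \<in> \<int> \<Longrightarrow> x \<in> int_lattice \<Longrightarrow> c *\<^sub>R x \<in> int_lattice"
  by (simp add: int_lattice_def)

lemma int_lattice_sum: "(\<And>i. i \<in> I \<Longrightarrow> g i \<in> int_lattice) \<Longrightarrow> sum g I \<in> int_lattice"
  by (induction I rule: infinite_finite_induct) (auto intro: int_lattice_add int_lattice_zero)

text \<open>The empty set is excluded: precomposing a valuation with \<open>Q \<mapsto> convex hull (insert a Q)\<close> or
  with dilation by \<open>0\<close> gives a valuation only on nonempty polytopes.\<close>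

definition lpolys :: "(real ^ 'n::finite) set set" where
  "lpolys = {convex hull A | A. finite A \<and> A \<noteq> {} \<and> A \<subseteq> int_lattice}"

lemma lpolysI: "finite A \<Longrightarrow> A \<noteq> {} \<Longrightarrow> A \<subseteq> int_lattice \<Longrightarrow> convex hull A \<in> lpolys"
  by (auto simp: lpolys_def)

lemma lpolysE:
  assumes "P \<in> lpolys"
  obtains A where "finite A" "A \<noteq> {}" "A \<subseteq> int_lattice" "P = convex hull A"
  using assms by (auto simp: lpolys_def)

text \<open>Generating sets replace extreme points as the working description: they may be
  redundant, so linear images and Minkowski sums stay in the class without identifying
  vertices.\<close>

lemma lattice_polytopes_eq: "lattice_polytopes = insert {} lpolys"
proof (intro equalityI subsetI)
  fix P :: "(real ^ 'n) set"
  assume P: "P \<in> lattice_polytopes"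
  have "polytope P" using P by (simp add: lattice_polytopes_def)
  then have "P = convex hull {x. x extreme_point_of P}"
    using Krein_Milman_Minkowski polytope_imp_compact polytope_imp_convex by blast
  moreover have "finite {x. x extreme_point_of P}"
    using \<open>polytope P\<close> finite_polyhedron_extreme_points polytope_imp_polyhedron by blast
  ultimately show "P \<in> insert {} lpolys"
    using P lpolysI[of "{x. x extreme_point_of P}"]
    by (cases "{x. x extreme_point_of P} = {}") (simp_all add: lattice_polytopes_def)
next
  fix P :: "(real ^ 'n) set"
  assume "P \<in> insert {} lpolys"
  then obtain A where "finite A" "A \<subseteq> int_lattice" "P = convex hull A"
    by (metis convex_hull_empty empty_subsetI finite.emptyI insert_iff lpolysE)
  then show "P \<in> lattice_polytopes"
    using extreme_point_of_convex_hull[of _ A]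
    by (auto simp: lattice_polytopes_def polytope_def)
qed

lemma lpolys_nonempty: "P \<in> lpolys \<Longrightarrow> P \<noteq> {}"
  by (auto elim!: lpolysE)

lemma lpolys_polytope: "P \<in> lpolys \<Longrightarrow> polytope P"
  by (auto elim!: lpolysE simp: polytope_def)

lemma lpolys_convex: "P \<in> lpolys \<Longrightarrow> convex P"
  by (auto elim!: lpolysE)

lemma lpolys_compact: "P \<in> lpolys \<Longrightarrow> compact P"
  by (simp add: lpolys_polytope polytope_imp_compact)

lemma lpolys_linear_image:
  assumes "P \<in> lpolys" "linear h" "h ` int_lattice \<subseteq> int_lattice"
  shows "h ` P \<in> lpolys"
proof -
  obtain A where A: "finite A" "A \<noteq> {}" "A \<subseteq> int_lattice" "P = convex hull A"
    using assms(1) by (rule lpolysE)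
  have "h ` P = convex hull (h ` A)"
    using A convex_hull_linear_image[OF assms(2)] by simp
  then show ?thesis using A assms(3) by (metis finite_imageI image_is_empty image_mono lpolysI order_trans)
qed

lemma lpolys_scale: "P \<in> lpolys \<Longrightarrow> c \<in> \<int> \<Longrightarrow> (*\<^sub>R) c ` P \<in> lpolys"
  by (rule lpolys_linear_image) (auto intro: int_lattice_scale)

lemma lpolys_uminus: "P \<in> lpolys \<Longrightarrow> uminus ` P \<in> lpolys"
  using lpolys_scale[of P "-1"] by simp

lemma lpolys_plus:
  assumes "P \<in> lpolys" "Q \<in> lpolys"
  shows "P + Q \<in> lpolys"
proof -
  obtain A where A: "finite A" "A \<noteq> {}" "A \<subseteq> int_lattice" "P = convex hull A"
    using assms(1) by (rule lpolysE)
  obtain B where B: "finite B" "B \<noteq> {}" "B \<subseteq> int_lattice" "Q = convex hull B"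
    using assms(2) by (rule lpolysE)
  have "P + Q = convex hull (A + B)" by (simp add: A B convex_hull_set_plus)
  moreover have "finite (A + B)" "A + B \<noteq> {}" "A + B \<subseteq> int_lattice"
    using A B by (auto simp: finite_set_plus elim!: set_plus_elim intro!: int_lattice_add)
  ultimately show ?thesis by (metis lpolysI)
qed

lemma lpolys_singleton: "y \<in> int_lattice \<Longrightarrow> {y} \<in> lpolys"
  using lpolysI[of "{y}"] by simp

lemma lpolys_face:
  assumes "P \<in> lpolys" "F face_of P" "F \<noteq> {}"
  shows "F \<in> lpolys"
proof -
  obtain A where A: "finite A" "A \<noteq> {}" "A \<subseteq> int_lattice" "P = convex hull A"
    using assms(1) by (rule lpolysE)
  obtain B where "B \<subseteq> A" "F = convex hull B"
    using face_of_convex_hull_subset[of A F] A assms(2) finite_imp_compact by metis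
  then show ?thesis using A assms(3) lpolysI[of B] by (metis convex_hull_eq_empty finite_subset order_trans)
qed

lemma translation_eq_plus: "(\<lambda>x. x + y) ` P = {y} + (P :: (real ^ 'n::finite) set)"
  by (auto simp: set_plus_def add.commute)

text \<open>Leaving out the empty set loses no relation between nonempty polytopes: if their union
  is convex, connectedness forces two closed sets that cover it to meet.\<close>

definition weak_val :: "((real ^ 'n::finite) set \<Rightarrow> real) \<Rightarrow> bool" where
  "weak_val f \<longleftrightarrow> (\<forall>P\<in>lpolys. \<forall>Q\<in>lpolys. P \<union> Q \<in> lpolys \<longrightarrow> P \<inter> Q \<in> lpolys \<longrightarrow>
     f P + f Q = f (P \<union> Q) + f (P \<inter> Q))"

lemma weak_valI:
  assumes "\<And>P Q. P \<in> lpolys \<Longrightarrow> Q \<in> lpolys \<Longrightarrow> P \<union> Q \<in> lpolys \<Longrightarrow> P \<inter> Q \<in> lpolys \<Longrightarrow>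
    f P + f Q = f (P \<union> Q) + f (P \<inter> Q)"
  shows "weak_val f"
  using assms by (auto simp: weak_val_def)

lemma weak_valD:
  assumes "weak_val f" "P \<in> lpolys" "Q \<in> lpolys" "P \<union> Q \<in> lpolys" "P \<inter> Q \<in> lpolys"
  shows "f P + f Q = f (P \<union> Q) + f (P \<inter> Q)"
  using assms by (auto simp: weak_val_def)

lemma weak_val_diff: "weak_val f \<Longrightarrow> weak_val g \<Longrightarrow> weak_val (\<lambda>P. f P - g P)"
  unfolding weak_val_def by (metis add_diff_add)

text \<open>The map may fail to be injective, as dilation by 0 does. The segment between two
  preimages of a point lies in one fibre; being connected and covered by two closed sets, it meets
  their intersection.\<close>

lemma linear_image_Int_convex_Un:
  assumes "linear h" "closed P" "closed Q" "convex (P \<union> Q)"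
  shows "h ` (P \<inter> Q) = h ` P \<inter> h ` (Q :: (real ^ 'n::finite) set)"
proof (intro equalityI subsetI)
  fix z assume "z \<in> h ` P \<inter> h ` Q"
  then obtain p q where pq: "p \<in> P" "q \<in> Q" "z = h p" "z = h q" by auto
  have seg: "closed_segment p q \<subseteq> P \<union> Q"
    using assms(4) pq by (simp add: closed_segment_subset)
  have "connected (closed_segment p q)" by simp
  then have "P \<inter> Q \<inter> closed_segment p q \<noteq> {}"
    using assms(2,3) pq seg connected_closedD by (metis IntI ends_in_segment empty_iff)
  then obtain w where w: "w \<in> P" "w \<in> Q" "w \<in> closed_segment p q" by auto
  then obtain t where "w = (1 - t) *\<^sub>R p + t *\<^sub>R q" by (auto simp: in_segment)
  then have "h w = (1 - t) *\<^sub>R z + t *\<^sub>R z"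
    using assms(1) pq by (simp add: linear_add linear_scale)
  then have "h w = z" by (simp add: scaleR_left_distrib[symmetric])
  then show "z \<in> h ` (P \<inter> Q)" using w by auto
qed auto

lemma weak_val_scale:
  assumes "weak_val f" "c \<in> \<int>"
  shows "weak_val (\<lambda>P. f ((*\<^sub>R) c ` P))"
proof (rule weak_valI)
  fix P Q :: "(real ^ 'a) set"
  assume PQ: "P \<in> lpolys" "Q \<in> lpolys" "P \<union> Q \<in> lpolys" "P \<inter> Q \<in> lpolys"
  have "(*\<^sub>R) c ` (P \<inter> Q) = (*\<^sub>R) c ` P \<inter> (*\<^sub>R) c ` Q"
    using PQ by (intro linear_image_Int_convex_Un) (auto simp: lpolys_convex lpolys_compact compact_imp_closed)
  then show "f ((*\<^sub>R) c ` P) + f ((*\<^sub>R) c ` Q) = f ((*\<^sub>R) c ` (P \<union> Q)) + f ((*\<^sub>R) c ` (P \<inter> Q))"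
    using weak_valD[OF assms(1) PQ(1,2)[THEN lpolys_scale[OF _ assms(2)]]]
      PQ(3,4)[THEN lpolys_scale[OF _ assms(2)]] by (simp add: image_Un)
qed

text \<open>Minkowski addition respects the intersection because the union is convex: if z = a + p =
  b + q, the segment from p to q meets the intersection at some parameter t, and mixing the two
  representations of z with this t puts the second summand there.\<close>

lemma weak_val_plus:
  assumes "weak_val f" "K \<in> lpolys"
  shows "weak_val (\<lambda>P. f (K + P))"
proof (rule weak_valI)
  fix P Q :: "(real ^ 'a) set"
  assume PQ: "P \<in> lpolys" "Q \<in> lpolys" "P \<union> Q \<in> lpolys" "P \<inter> Q \<in> lpolys"
  have "K + (P \<union> Q) = (K + P) \<union> (K + Q)" by (auto simp: set_plus_def)
  moreover have "K + (P \<inter> Q) = (K + P) \<inter> (K + Q)"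
  proof (intro equalityI subsetI)
    fix z assume "z \<in> (K + P) \<inter> (K + Q)"
    then obtain a b p q where z: "a \<in> K" "p \<in> P" "z = a + p" "b \<in> K" "q \<in> Q" "z = b + q"
      by (auto simp: set_plus_def)
    have "closed_segment p q \<subseteq> P \<union> Q"
      using PQ z by (simp add: closed_segment_subset lpolys_convex)
    moreover have "connected (closed_segment p q)" by simp
    ultimately have "P \<inter> Q \<inter> closed_segment p q \<noteq> {}"
      using PQ z connected_closedD lpolys_compact compact_imp_closed
      by (metis IntI ends_in_segment empty_iff)
    then obtain w where w: "w \<in> P \<inter> Q" "w \<in> closed_segment p q" by auto
    then obtain t where "w = (1 - t) *\<^sub>R p + t *\<^sub>R q" "0 \<le> t" "t \<le> 1"
      by (auto simp: in_segment)
    with w(1) have t: "(1 - t) *\<^sub>R p + t *\<^sub>R q \<in> P \<inter> Q" "0 \<le> t" "t \<le> 1" by auto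
    have "z = (1 - t) *\<^sub>R z + t *\<^sub>R z" by (simp add: scaleR_left_distrib[symmetric])
    also have "(1 - t) *\<^sub>R z = (1 - t) *\<^sub>R a + (1 - t) *\<^sub>R p"
      unfolding z(3) by (rule scaleR_right_distrib)
    also have "t *\<^sub>R z = t *\<^sub>R b + t *\<^sub>R q"
      unfolding z(6) by (rule scaleR_right_distrib)
    also have "(1 - t) *\<^sub>R a + (1 - t) *\<^sub>R p + (t *\<^sub>R b + t *\<^sub>R q)
        = ((1 - t) *\<^sub>R a + t *\<^sub>R b) + ((1 - t) *\<^sub>R p + t *\<^sub>R q)"
      by (simp only: ac_simps)
    finally show "z \<in> K + (P \<inter> Q)"
      using t z(1,4) convexD[OF lpolys_convex[OF assms(2)], of a b "1 - t" t] by (auto simp: set_plus_def)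
  qed (auto simp: set_plus_def)
  ultimately show "f (K + P) + f (K + Q) = f (K + (P \<union> Q)) + f (K + (P \<inter> Q))"
    using weak_valD[OF assms(1) PQ(1,2)[THEN lpolys_plus[OF assms(2)]]]
      PQ(3,4)[THEN lpolys_plus[OF assms(2)]] by simp
qed

subsection \<open>Cutting hulls\<close>

lemma convex_hull_Un_decomp:
  fixes A C :: "'a::euclidean_space set"
  assumes "z \<in> convex hull (A \<union> C)" "A \<noteq> {}" "C \<noteq> {}"
  obtains a c s where "a \<in> convex hull A" "c \<in> convex hull C" "0 \<le> s" "s \<le> 1"
    "z = s *\<^sub>R a + (1 - s) *\<^sub>R c"
proof -
  have "convex hull (A \<union> C) = convex hull (convex hull A \<union> convex hull C)"
    by (rule hull_Un) (auto intro: convex_Inter)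
  also have "\<dots> = {u *\<^sub>R a + v *\<^sub>R c | u v a c. u \<ge> 0 \<and> v \<ge> 0 \<and> u + v = 1 \<and> a \<in> convex hull A \<and> c \<in> convex hull C}"
    using assms by (intro convex_hull_union_two) auto
  finally obtain u v a c where *: "0 \<le> u" "0 \<le> v" "u + v = 1" "a \<in> convex hull A" "c \<in> convex hull C"
    "z = u *\<^sub>R a + v *\<^sub>R c" using assms(1) by auto
  then have "v = 1 - u" by simp
  with * show ?thesis by (intro that[of a c u]) auto
qed

lemma convex_comb_3:
  assumes "convex S" "p \<in> S" "q \<in> S" "r \<in> S" "0 \<le> a" "0 \<le> b" "0 \<le> c" "a + b + c = 1"
  shows "a *\<^sub>R p + b *\<^sub>R q + c *\<^sub>R r \<in> S"
proof -
  have "a *\<^sub>R p + b *\<^sub>R q + c *\<^sub>R r \<in> convex hull {p, q, r}"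
    using assms by (auto simp: convex_hull_3)
  then show ?thesis using assms(1-4) by (metis empty_subsetI hull_minimal insert_subset subsetD)
qed

text \<open>Eliminating x in favour of the crossing point p on the segment from x to y leaves y with
  weight \<beta> - \<alpha> t / (1 - t), which the last assumption makes nonnegative.\<close>

lemma convex_hull_cut_aux:
  fixes A B C :: "'a::euclidean_space set"
  assumes "0 \<le> t" "t < 1" and x: "x \<in> convex hull A" and y: "y \<in> convex hull B"
    and c: "c \<in> convex hull C"
    and cross: "(1 - t) *\<^sub>R x + t *\<^sub>R y \<in> convex hull C"
    and "0 \<le> \<alpha>" "0 \<le> \<beta>" "0 \<le> \<gamma>" "\<alpha> + \<beta> + \<gamma> = 1" "\<alpha> * t \<le> \<beta> * (1 - t)"
  shows "\<alpha> *\<^sub>R x + \<beta> *\<^sub>R y + \<gamma> *\<^sub>R c \<in> convex hull (B \<union> C)"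
proof -
  define p where "p = (1 - t) *\<^sub>R x + t *\<^sub>R y"
  have "(\<alpha> / (1 - t)) *\<^sub>R p = \<alpha> *\<^sub>R x + (\<alpha> * t / (1 - t)) *\<^sub>R y"
    using assms by (simp add: p_def scaleR_right_distrib)
  then have eq: "\<alpha> *\<^sub>R x + \<beta> *\<^sub>R y + \<gamma> *\<^sub>R c
      = (\<alpha> / (1 - t)) *\<^sub>R p + (\<beta> - \<alpha> * t / (1 - t)) *\<^sub>R y + \<gamma> *\<^sub>R c"
    by (simp add: scaleR_left_diff_distrib)
  have sub: "convex hull C \<subseteq> convex hull (B \<union> C)" "convex hull B \<subseteq> convex hull (B \<union> C)"
    by (auto intro: hull_mono[THEN subsetD])
  show ?thesis unfolding eq
  proof (rule convex_comb_3)
    have "\<alpha> / (1 - t) - \<alpha> * t / (1 - t) = \<alpha>"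
      using assms by (simp add: diff_divide_distrib[symmetric]) (simp add: field_simps)
    then show "\<alpha> / (1 - t) + (\<beta> - \<alpha> * t / (1 - t)) + \<gamma> = 1"
      using assms by linarith
    show "0 \<le> \<beta> - \<alpha> * t / (1 - t)"
      using assms by (simp add: field_simps)
  qed (use assms sub cross in \<open>auto simp: p_def\<close>)
qed

lemma convex_hull_cut:
  fixes A B C :: "'a::euclidean_space set"
  assumes t: "0 \<le> t" "t < 1" and C: "C \<noteq> {}"
    and cross: "\<And>x y. x \<in> convex hull A \<Longrightarrow> y \<in> convex hull B \<Longrightarrow> (1 - t) *\<^sub>R x + t *\<^sub>R y \<in> convex hull C"
  shows "convex hull (A \<union> B \<union> C) = convex hull (A \<union> C) \<union> convex hull (B \<union> C)" (is ?Un)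
    and "convex hull C = convex hull (A \<union> C) \<inter> convex hull (B \<union> C)" (is ?Int)
proof -
  have mono: "convex hull (A \<union> C) \<subseteq> convex hull (A \<union> B \<union> C)"
     "convex hull (B \<union> C) \<subseteq> convex hull (A \<union> B \<union> C)"
     "convex hull C \<subseteq> convex hull (A \<union> C)" "convex hull C \<subseteq> convex hull (B \<union> C)"
    by (intro hull_mono; blast)+
  have "?Un \<and> ?Int"
  proof (cases "A = {} \<or> B = {}")
    case True
    then show ?thesis using mono by auto
  next
    case False
    then have AB: "A \<noteq> {}" "B \<noteq> {}" by auto
    have "convex hull (A \<union> B \<union> C) \<subseteq> convex hull (A \<union> C) \<union> convex hull (B \<union> C)"
    proof
      fix z assume z: "z \<in> convex hull (A \<union> B \<union> C)"
      then obtain w c s where 1: "w \<in> convex hull (A \<union> B)" "c \<in> convex hull C" "0 \<le> s" "s \<le> 1"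
        "z = s *\<^sub>R w + (1 - s) *\<^sub>R c"
        using convex_hull_Un_decomp[of z "A \<union> B" C] z AB C by blast
      obtain x y r where 2: "x \<in> convex hull A" "y \<in> convex hull B" "0 \<le> r" "r \<le> 1"
        "w = r *\<^sub>R x + (1 - r) *\<^sub>R y"
        using convex_hull_Un_decomp[of w A B] 1(1) AB by blast
      have z1: "z = (s * r) *\<^sub>R x + (s * (1 - r)) *\<^sub>R y + (1 - s) *\<^sub>R c"
        by (simp add: 1 2 scaleR_right_distrib)
      then have z2: "z = (s * (1 - r)) *\<^sub>R y + (s * r) *\<^sub>R x + (1 - s) *\<^sub>R c" by simp
      have sum: "s * r + s * (1 - r) + (1 - s) = 1" "s * (1 - r) + s * r + (1 - s) = 1"
        by (simp_all add: algebra_simps)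
      show "z \<in> convex hull (A \<union> C) \<union> convex hull (B \<union> C)"
      proof (cases "s * r * t \<le> s * (1 - r) * (1 - t)")
        case True
        have "z \<in> convex hull (B \<union> C)" unfolding z1
          by (rule convex_hull_cut_aux[OF t 2(1,2) 1(2) cross[OF 2(1,2)]])
            (use True sum 1 2 in auto)
        then show ?thesis by blast
      next
        case False
        \<comment> \<open>For t = 0 the inequality of the case split would hold. With t positive,
          the auxiliary lemma applies with A and B exchanged and 1 - t in place of t.\<close>
        have "t \<noteq> 0"
        proof
          assume "t = 0"
          then show False using False 1 2 by simp
        qed
        have "z \<in> convex hull (A \<union> C)" unfolding z2
          by (rule convex_hull_cut_aux[of "1 - t" _ B])
            (use t \<open>t \<noteq> 0\<close> False sum 1 2 cross[OF 2(1,2)] in \<open>auto simp: add.commute\<close>)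
        then show ?thesis by blast
      qed
    qed
    moreover have "convex hull (A \<union> C) \<inter> convex hull (B \<union> C) \<subseteq> convex hull C"
    proof
      fix z assume z: "z \<in> convex hull (A \<union> C) \<inter> convex hull (B \<union> C)"
      obtain x c s where 1: "x \<in> convex hull A" "c \<in> convex hull C" "0 \<le> s" "s \<le> 1"
        "z = s *\<^sub>R x + (1 - s) *\<^sub>R c"
        using convex_hull_Un_decomp[of z A C] z AB C by blast
      obtain y c' r where 2: "y \<in> convex hull B" "c' \<in> convex hull C" "0 \<le> r" "r \<le> 1"
        "z = r *\<^sub>R y + (1 - r) *\<^sub>R c'"
        using convex_hull_Un_decomp[of z B C] z AB C by blast
      show "z \<in> convex hull C"
      proof (cases "r = 0")
        case True
        then show ?thesis using 2 by simp
      next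
        case False
        then have r: "r > 0" using 2 by simp
        \<comment> \<open>The two representations of z are added with weights r (1 - t) and s t,
          chosen so that x and y occur in the ratio 1 - t to t and merge into a multiple of the
          crossing point p. \<open>D\<close> is the sum of these weights.\<close>
        define D where "D = s * t + r * (1 - t)"
        have D: "D > 0" unfolding D_def using r t 1 by (simp add: add_nonneg_pos)
        define p where "p = (1 - t) *\<^sub>R x + t *\<^sub>R y"
        have "D *\<^sub>R z = (r * (1 - t)) *\<^sub>R z + (s * t) *\<^sub>R z"
          by (simp add: D_def scaleR_left_distrib)
        also have "(r * (1 - t)) *\<^sub>R z = (r * (1 - t) * s) *\<^sub>R x + (r * (1 - t) * (1 - s)) *\<^sub>R c"
          by (subst 1(5)) (simp add: scaleR_right_distrib)
        also have "(s * t) *\<^sub>R z = (s * t * r) *\<^sub>R y + (s * t * (1 - r)) *\<^sub>R c'"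
          by (subst 2(5)) (simp add: scaleR_right_distrib)
        finally have "D *\<^sub>R z = (r * s) *\<^sub>R p + (r * (1 - t) * (1 - s)) *\<^sub>R c + (s * t * (1 - r)) *\<^sub>R c'"
          by (simp add: p_def scaleR_right_distrib algebra_simps)
        then have "(1 / D) *\<^sub>R (D *\<^sub>R z) = (1 / D) *\<^sub>R ((r * s) *\<^sub>R p + (r * (1 - t) * (1 - s)) *\<^sub>R c + (s * t * (1 - r)) *\<^sub>R c')"
          by simp
        then have "z = (r * s / D) *\<^sub>R p + (r * (1 - t) * (1 - s) / D) *\<^sub>R c + (s * t * (1 - r) / D) *\<^sub>R c'"
          using D by (simp add: scaleR_right_distrib)
        moreover have "r * s / D + r * (1 - t) * (1 - s) / D + s * t * (1 - r) / D = 1"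
          using D by (simp add: add_divide_distrib[symmetric]) (simp add: D_def algebra_simps)
        ultimately show ?thesis
          using convex_comb_3[of "convex hull C" p c c'] cross[OF 1(1) 2(1)] 1 2 t D r
          by (simp add: p_def)
      qed
    qed
    ultimately show ?thesis using mono by blast
  qed
  then show ?Un ?Int by auto
qed

lemma weak_val_cut:
  assumes "weak_val f" and t: "0 \<le> t" "t < 1" and C: "C \<noteq> {}"
    and fin: "finite A" "finite B" "finite C" and int: "A \<union> B \<union> C \<subseteq> int_lattice"
    and cross: "\<And>x y. x \<in> convex hull A \<Longrightarrow> y \<in> convex hull B \<Longrightarrow> (1 - t) *\<^sub>R x + t *\<^sub>R y \<in> convex hull C"
  shows "f (convex hull (A \<union> B \<union> C)) = f (convex hull (A \<union> C)) + f (convex hull (B \<union> C)) - f (convex hull C)"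
proof -
  note cut = convex_hull_cut[OF t C cross]
  have "convex hull (A \<union> C) \<in> lpolys" "convex hull (B \<union> C) \<in> lpolys" "convex hull C \<in> lpolys"
    "convex hull (A \<union> B \<union> C) \<in> lpolys"
    using C fin int by (auto intro!: lpolysI)
  then show ?thesis
    using weak_valD[OF assms(1), of "convex hull (A \<union> C)" "convex hull (B \<union> C)"] cut by simp
qed

lemma sum_Pow_insert:
  assumes "finite X" "a \<notin> X"
  shows "sum c (Pow (insert a X)) = sum c (Pow X) + (\<Sum>S\<in>Pow X. c (insert a S))"
proof -
  have "sum c (Pow (insert a X)) = sum c (Pow X) + sum c (insert a ` Pow X)"
    unfolding Pow_insert using assms by (intro sum.union_disjoint) auto
  also have "sum c (insert a ` Pow X) = (\<Sum>S\<in>Pow X. c (insert a S))"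
    using assms(2) by (subst sum.reindex) (auto simp: inj_on_def)
  finally show ?thesis .
qed

section \<open>Linear relations from Radon partitions\<close>

lemma weak_val_two_points:
  assumes "weak_val f" "finite B" "B \<subseteq> int_lattice" "a \<in> int_lattice" "b \<in> int_lattice"
    and x: "(1 - t) *\<^sub>R a + t *\<^sub>R b \<in> convex hull B" and t: "0 \<le> t" "t < 1"
  shows "f (convex hull (insert a (insert b B))) + f (convex hull B)
       = f (convex hull (insert a B)) + f (convex hull (insert b B))"
proof -
  have "B \<noteq> {}" using x by auto
  then have "f (convex hull ({a} \<union> {b} \<union> B)) = f (convex hull ({a} \<union> B)) + f (convex hull ({b} \<union> B)) - f (convex hull B)"
    using assms by (intro weak_val_cut[OF assms(1) t]) auto
  then show ?thesis by (simp add: insert_commute)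
qed

text \<open>If \<open>x \<in> convex hull B\<close> lies on the segment from \<open>a\<close> to \<open>y \<in> convex hull I\<close>, prolong it to a
  lattice point \<open>w\<close> beyond \<open>y\<close>. The two-point relation for \<open>a, w\<close> allows adding \<open>w\<close> to \<open>B\<close>, and
  then \<open>y\<close> lies in \<open>convex hull (insert w B)\<close>, so that \<open>a\<close> can be dropped from the set of points.
  Rationality of \<open>x\<close> (the weights \<open>c\<close>) is what makes \<open>w\<close> available.\<close>

lemma weak_val_alternating_sum:
  assumes f: "weak_val f" and I: "finite I" "I \<noteq> {}"
    and "I \<subseteq> int_lattice" "\<forall>i\<in>I. (c i :: nat) > 0"
    and "finite B" "B \<subseteq> int_lattice" "x \<in> convex hull B"
    and "(\<Sum>i\<in>I. real (c i) *\<^sub>R i) = real (\<Sum>i\<in>I. c i) *\<^sub>R x"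
  shows "(\<Sum>S\<in>Pow I. (-1) ^ card S * f (convex hull (B \<union> S))) = 0"
  using I assms(4-)
proof (induction I arbitrary: B x rule: finite_ne_induct)
  case (singleton a)
  then have "a \<in> convex hull B" by simp
  then have "convex hull (insert a B) = convex hull B" by (metis hull_redundant)
  then show ?case by (simp add: Pow_insert)
next
  case (insert a I)
  define \<beta> where "\<beta> = real (\<Sum>i\<in>I. c i)"
  define \<Lambda> where "\<Lambda> = real (c a) + \<beta>"
  \<comment> \<open>\<open>\<Lambda>\<close> is the total weight, so \<open>\<Lambda>\<close> x is
    an integer combination of lattice points and w is a lattice point. In terms of y, w = a +
    \<beta> (y - a), which lies beyond y since \<beta> \<ge> 1.\<close>
  define w where "w = a + \<Lambda> *\<^sub>R (x - a)"
  define y where "y = (1 / \<beta>) *\<^sub>R (\<Sum>i\<in>I. real (c i) *\<^sub>R i)"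
  have "(\<Sum>i\<in>I. c i) > 0"
    using insert.hyps insert.prems by (intro sum_pos) auto
  then have \<beta>: "\<beta> \<ge> 1" unfolding \<beta>_def by linarith
  have ca: "real (c a) \<ge> 1" using insert.prems by (simp add: Suc_leI)
  have \<Lambda>: "\<Lambda> \<ge> 2" using \<beta> ca by (simp add: \<Lambda>_def)
  have \<Lambda>x: "\<Lambda> *\<^sub>R x = real (c a) *\<^sub>R a + \<beta> *\<^sub>R y"
    using insert.prems(6) insert.hyps \<beta> by (simp add: \<Lambda>_def \<beta>_def y_def)
  have sumI: "(\<Sum>i\<in>I. real (c i) *\<^sub>R i) = \<beta> *\<^sub>R y" using \<beta> by (simp add: y_def)
  have w_int: "w \<in> int_lattice"
  proof -
    have "w = (1 - \<Lambda>) *\<^sub>R a + (real (c a) *\<^sub>R a + (\<Sum>i\<in>I. real (c i) *\<^sub>R i))"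
      using \<Lambda>x by (simp add: w_def sumI algebra_simps)
    moreover have "1 - \<Lambda> \<in> \<int>" by (simp add: \<Lambda>_def \<beta>_def del: of_nat_sum)
    ultimately show ?thesis using insert.prems
      by (auto intro!: int_lattice_add int_lattice_scale int_lattice_sum)
  qed
  have seg: "(1 - 1 / \<Lambda>) *\<^sub>R a + (1 / \<Lambda>) *\<^sub>R w = x"
    using \<Lambda> by (simp add: w_def algebra_simps)
  have "\<beta> *\<^sub>R y = (\<Lambda> * (\<beta> - 1) / (\<Lambda> - 1)) *\<^sub>R x + (real (c a) / (\<Lambda> - 1)) *\<^sub>R w"
  proof -
    have "(\<Lambda> - 1) *\<^sub>R (\<beta> *\<^sub>R y) = (\<Lambda> * (\<beta> - 1)) *\<^sub>R x + real (c a) *\<^sub>R w"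
    proof -
      have e: "\<beta> *\<^sub>R y = \<Lambda> *\<^sub>R x - real (c a) *\<^sub>R a" using \<Lambda>x by simp
      show ?thesis unfolding e w_def by (simp add: \<Lambda>_def algebra_simps)
    qed
    then have "(1 / (\<Lambda> - 1)) *\<^sub>R ((\<Lambda> - 1) *\<^sub>R (\<beta> *\<^sub>R y)) = (1 / (\<Lambda> - 1)) *\<^sub>R ((\<Lambda> * (\<beta> - 1)) *\<^sub>R x + real (c a) *\<^sub>R w)"
      by simp
    then show ?thesis using \<Lambda> by (simp add: scaleR_right_distrib)
  qed
  then have "(1 / \<beta>) *\<^sub>R (\<beta> *\<^sub>R y) = (1 / \<beta>) *\<^sub>R ((\<Lambda> * (\<beta> - 1) / (\<Lambda> - 1)) *\<^sub>R x + (real (c a) / (\<Lambda> - 1)) *\<^sub>R w)"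
    by simp
  then have y_eq: "y = (\<Lambda> * (\<beta> - 1) / (\<Lambda> - 1) / \<beta>) *\<^sub>R x + (real (c a) / (\<Lambda> - 1) / \<beta>) *\<^sub>R w"
    using \<beta> by (simp add: scaleR_right_distrib mult.commute)
  have y1: "\<Lambda> * (\<beta> - 1) / (\<Lambda> - 1) / \<beta> + real (c a) / (\<Lambda> - 1) / \<beta> = 1"
    using \<beta> \<Lambda> by (simp add: divide_simps) (simp add: \<Lambda>_def algebra_simps)
  have y_in: "y \<in> convex hull (insert w B')" if "B \<subseteq> B'" for B'
  proof -
    have "x \<in> convex hull (insert w B')" "w \<in> convex hull (insert w B')"
      using insert.prems(5) hull_mono[of B "insert w B'" convex] that by (auto intro: hull_inc)
    moreover have "0 \<le> \<Lambda> * (\<beta> - 1) / (\<Lambda> - 1) / \<beta>" "0 \<le> real (c a) / (\<Lambda> - 1) / \<beta>"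
      using \<beta> \<Lambda> by auto
    ultimately show ?thesis unfolding y_eq
      using y1 by (intro convexD) auto
  qed
  have IH: "(\<Sum>S\<in>Pow I. (-1) ^ card S * f (convex hull (insert w B' \<union> S))) = 0"
    if "finite B'" "B' \<subseteq> int_lattice" "B \<subseteq> B'" for B'
    using that insert.prems w_int y_in[of B'] by (intro insert.IH[of _ y]) (auto simp: sumI \<beta>_def)
  have "(\<Sum>S\<in>Pow (insert a I). (-1) ^ card S * f (convex hull (B \<union> S)))
      = (\<Sum>S\<in>Pow I. (-1) ^ card S * f (convex hull (B \<union> S)))
        - (\<Sum>S\<in>Pow I. (-1) ^ card S * f (convex hull (insert a B \<union> S)))"
  proof -
    have "card (insert a S) = Suc (card S)" if "S \<in> Pow I" for S
      using that insert.hyps finite_subset by (metis PowD card_insert_disjoint subsetD)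
    then show ?thesis
      using insert.hyps by (subst sum_Pow_insert) (auto simp: sum_negf[symmetric])
  qed
  \<comment> \<open>The two new sums vanish by the induction hypothesis for \<open>B\<close> and for
    \<open>insert a B\<close>. With them, the four terms belonging to one \<open>S\<close> form the
    two-point relation for \<open>a\<close> and \<open>w\<close> over
    \<open>B \<union> S\<close>.\<close>
  also have "\<dots> = (\<Sum>S\<in>Pow I. (-1) ^ card S * f (convex hull (B \<union> S)))
        - (\<Sum>S\<in>Pow I. (-1) ^ card S * f (convex hull (insert a B \<union> S)))
        - (\<Sum>S\<in>Pow I. (-1) ^ card S * f (convex hull (insert w B \<union> S)))
        + (\<Sum>S\<in>Pow I. (-1) ^ card S * f (convex hull (insert w (insert a B) \<union> S)))"
    using IH[of B] IH[of "insert a B"] insert.prems by auto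
  also have "\<dots> = (\<Sum>S\<in>Pow I. (-1) ^ card S * (f (convex hull (B \<union> S))
        - f (convex hull (insert a B \<union> S)) - f (convex hull (insert w B \<union> S))
        + f (convex hull (insert w (insert a B) \<union> S))))"
    by (simp add: sum.distrib sum_subtractf right_diff_distrib distrib_left)
  also have "\<dots> = 0"
  proof (rule sum.neutral, rule ballI)
    fix S assume "S \<in> Pow I"
    then have "f (convex hull (insert a (insert w (B \<union> S)))) + f (convex hull (B \<union> S))
       = f (convex hull (insert a (B \<union> S))) + f (convex hull (insert w (B \<union> S)))"
      using insert.prems insert.hyps w_int \<Lambda> seg hull_mono[of B "B \<union> S" convex] finite_subset[of S I]
      by (intro weak_val_two_points[OF f, where t = "1 / \<Lambda>"]) auto
    then show "(-1) ^ card S * (f (convex hull (B \<union> S))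
        - f (convex hull (insert a B \<union> S)) - f (convex hull (insert w B \<union> S))
        + f (convex hull (insert w (insert a B) \<union> S))) = 0"
      by (simp add: insert_commute)
  qed
  finally show ?case .
qed

text \<open>Applying a \<open>\<rat>\<close>-linear functional to the coefficients of a real dependency between lattice
  points gives a rational one.\<close>

lemma rat_functional_exists:
  assumes "c \<noteq> 0"
  shows "\<exists>g :: real \<Rightarrow> rat. (\<forall>x y. g (x + y) = g x + g y) \<and> (\<forall>q x. g (of_rat q * x) = q * g x) \<and> g c = 1"
proof -
  interpret vp: vector_space_pair "\<lambda>q x. of_rat q * x :: real" "\<lambda>q x. q * x :: rat"
    by unfold_locales (auto simp: of_rat_add of_rat_mult algebra_simps)
  have "vp.vs1.independent {c}" using assms by (simp add: vp.vs1.dependent_single)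
  then obtain g where g: "Vector_Spaces.linear (\<lambda>q x. of_rat q * x) (\<lambda>q x. q * x) g" "g c = 1"
    using vp.linear_independent_extend[of "{c}" "\<lambda>_. 1"] by auto
  interpret g: Vector_Spaces.linear "\<lambda>q x. of_rat q * x :: real" "\<lambda>q x. q * x :: rat" g by (rule g(1))
  show ?thesis using g(2) g.add g.scale by blast
qed

section \<open>Integer dependencies and reduction to simplices\<close>

lemma rat_common_denominator:
  assumes "finite A"
  shows "\<exists>D::int. D > 0 \<and> (\<forall>a\<in>A. of_int D * (q a :: rat) \<in> \<int>)"
  using assms
proof induction
  case (insert a A)
  then obtain D where D: "D > 0" "\<forall>a\<in>A. of_int D * q a \<in> \<int>" by auto
  obtain m n where q: "q a = Fract m n" "n > 0" by (metis Rat_cases)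
  have "of_int (D * n) * q b \<in> \<int>" if "b \<in> insert a A" for b
  proof (cases "b = a")
    case True
    have "of_int (D * n) * q a = of_int (D * m)" using q by (simp add: Fract_of_int_quotient)
    then show ?thesis using True by (metis Ints_of_int)
  next
    case False
    have "of_int (D * n) * q b = of_int n * (of_int D * q b)" by simp
    then show ?thesis using D(2) False that by (metis Ints_mult Ints_of_int insertE)
  qed
  then show ?case using D(1) q(2) by (intro exI[of _ "D * n"]) auto
qed (auto intro: exI[of _ 1])

lemma affine_dependent_int_coeffs:
  assumes "finite A" "A \<subseteq> int_lattice" "affine_dependent A"
  obtains d :: "real ^ 'n::finite \<Rightarrow> int"
  where "sum d A = 0" "\<exists>a\<in>A. d a \<noteq> 0" "(\<Sum>a\<in>A. real_of_int (d a) *\<^sub>R a) = 0"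
proof -
  obtain U b where U: "sum U A = 0" "b \<in> A" "U b \<noteq> 0" "(\<Sum>v\<in>A. U v *\<^sub>R v) = 0"
    using assms(1,3) by (auto simp: affine_dependent_explicit_finite)
  \<comment> \<open>Coordinates of lattice points are integers, so \<open>g\<close> respects each
    coordinate of the dependency; the normalisation \<open>g (U b) = 1\<close> keeps the new
    dependency nontrivial.\<close>
  obtain g :: "real \<Rightarrow> rat" where g: "\<And>x y. g (x + y) = g x + g y" "\<And>q x. g (of_rat q * x) = q * g x" "g (U b) = 1"
    using rat_functional_exists[OF U(3)] by blast
  have g0: "g 0 = 0" using g(2)[of 0 0] by simp
  have gsum: "g (sum h S) = (\<Sum>s\<in>S. g (h s))" for h :: "real ^ 'n \<Rightarrow> real" and S
    by (induction S rule: infinite_finite_induct) (auto simp: g g0)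
  obtain D :: int where D: "D > 0" "\<And>a. a \<in> A \<Longrightarrow> of_int D * g (U a) \<in> \<int>"
    using rat_common_denominator[OF assms(1), of "\<lambda>a. g (U a)"] by blast
  define d where "d = (\<lambda>a. \<lfloor>of_int D * g (U a)\<rfloor>)"
  have d: "of_int (d a) = of_int D * g (U a)" if "a \<in> A" for a
    using D(2)[OF that] by (simp add: d_def)
  show ?thesis
  proof
    have "of_int (sum d A) = (of_int D * g (sum U A) :: rat)"
      by (simp add: gsum sum_distrib_left d)
    then have "of_int (sum d A) = (0 :: rat)" using U(1) g0 by simp
    then show "sum d A = 0" by (simp only: of_int_eq_0_iff)
    have "of_int (d b) = (of_int D :: rat)" using d U(2) g(3) by simp
    then show "\<exists>a\<in>A. d a \<noteq> 0" using U(2) D(1) by force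
    show "(\<Sum>a\<in>A. real_of_int (d a) *\<^sub>R a) = 0"
    proof (rule vec_eq_iff[THEN iffD2], rule allI)
      fix k
      have floor: "of_int \<lfloor>a $ k\<rfloor> = a $ k" if "a \<in> A" for a
      proof -
        have "a $ k \<in> \<int>" using assms(2) that by (auto simp: int_lattice_def)
        then show ?thesis by (metis Ints_cases floor_of_int)
      qed
      have z: "of_rat (of_int \<lfloor>a $ k\<rfloor>) = a $ k" if "a \<in> A" for a
        using floor[OF that] by simp
      have "0 = (\<Sum>a\<in>A. U a *\<^sub>R a) $ k" using U(4) by simp
      also have "\<dots> = (\<Sum>a\<in>A. of_rat (of_int \<lfloor>a $ k\<rfloor>) * U a)"
        by (auto simp: z mult.commute simp del: of_rat_of_int_eq intro!: sum.cong)
      finally have "0 = g (\<Sum>a\<in>A. of_rat (of_int \<lfloor>a $ k\<rfloor>) * U a)" using g0 by simp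
      also have "\<dots> = (\<Sum>a\<in>A. of_int \<lfloor>a $ k\<rfloor> * g (U a))" by (simp add: gsum g(2) del: of_rat_of_int_eq)
      finally have "0 = of_int D * (\<Sum>a\<in>A. of_int \<lfloor>a $ k\<rfloor> * g (U a))" by simp
      also have "\<dots> = of_int (\<Sum>a\<in>A. \<lfloor>a $ k\<rfloor> * d a)"
        by (simp add: d sum_distrib_left mult.left_commute)
      finally have "(\<Sum>a\<in>A. \<lfloor>a $ k\<rfloor> * d a) = 0" by (metis of_int_eq_0_iff)
      then have "real_of_int (\<Sum>a\<in>A. \<lfloor>a $ k\<rfloor> * d a) = 0" by simp
      then show "(\<Sum>a\<in>A. real_of_int (d a) *\<^sub>R a) $ k = 0 $ k"
        by (simp add: mult.commute floor)
    qed
  qed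
qed

text \<open>Induction on the number of generating points: in the alternating sum over subsets of
  \<open>I\<close>, every term except the one for \<open>I\<close> itself is the hull of fewer
  points. Vanishing is the form needed later, since it covers both differences of valuations and
  forward differences in the dilation factor.\<close>

lemma weak_val_zero_if_zero_on_simplices:
  assumes f: "weak_val f" and "P \<in> lpolys"
    and simplex: "\<And>A. finite A \<Longrightarrow> A \<noteq> {} \<Longrightarrow> A \<subseteq> int_lattice \<Longrightarrow> \<not> affine_dependent A \<Longrightarrow> f (convex hull A) = 0"
  shows "f P = 0"
proof -
  have "f (convex hull A) = 0" if "finite A" "A \<noteq> {}" "A \<subseteq> int_lattice" for A
    using that
  proof (induction "card A" arbitrary: A rule: less_induct)
    case less
    show ?case
    proof (cases "affine_dependent A")
      case False
      then show ?thesis using simplex less.prems by blast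
    next
      case True
      obtain d where d: "sum d A = 0" "\<exists>a\<in>A. d a \<noteq> 0" "(\<Sum>a\<in>A. real_of_int (d a) *\<^sub>R a) = 0"
        using affine_dependent_int_coeffs[OF less.prems(1,3) True] by blast
      define I where "I = {a \<in> A. d a > 0}"
      define J where "J = {a \<in> A. d a \<le> 0}"
      define \<Lambda> where "\<Lambda> = sum d I"
      have IJ: "I \<union> J = A" "I \<inter> J = {}" "finite I" "finite J" "I \<subseteq> A" "J \<subseteq> A"
        using less.prems by (auto simp: I_def J_def)
      have sumJ: "sum d J = - \<Lambda>"
        using d(1) IJ sum.union_disjoint[of I J d] by (simp add: \<Lambda>_def)
      have "I \<noteq> {}"
      proof
        assume "I = {}"
        then have "\<forall>a\<in>A. - d a \<ge> 0" by (force simp: I_def)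
        moreover have "(\<Sum>a\<in>A. - d a) = 0" using d(1) by (simp add: sum_negf)
        ultimately show False using d(2) less.prems(1)
          using sum_nonneg_eq_0_iff[of A "\<lambda>a. - d a"] by auto
      qed
      then have \<Lambda>: "\<Lambda> > 0" unfolding \<Lambda>_def using IJ by (intro sum_pos) (auto simp: I_def)
      define x where "x = (1 / real_of_int \<Lambda>) *\<^sub>R (\<Sum>a\<in>I. real_of_int (d a) *\<^sub>R a)"
      have xJ: "x = (\<Sum>a\<in>J. (real_of_int (- d a) / real_of_int \<Lambda>) *\<^sub>R a)"
      proof -
        have "(\<Sum>a\<in>I. real_of_int (d a) *\<^sub>R a) + (\<Sum>a\<in>J. real_of_int (d a) *\<^sub>R a) = 0"
          using d(3) IJ sum.union_disjoint[of I J "\<lambda>a. real_of_int (d a) *\<^sub>R a"] by simp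
        then have "(\<Sum>a\<in>I. real_of_int (d a) *\<^sub>R a) = (\<Sum>a\<in>J. real_of_int (- d a) *\<^sub>R a)"
          by (simp add: sum_negf add_eq_0_iff2)
        then show ?thesis by (simp add: x_def scaleR_sum_right sum_negf)
      qed
      have "x \<in> convex hull J" unfolding xJ
      proof (rule convex_sum)
        show "(\<Sum>i\<in>J. real_of_int (- d i) / real_of_int \<Lambda>) = 1"
          using sumJ \<Lambda> by (simp add: sum_divide_distrib[symmetric] sum_negf flip: of_int_sum)
      qed (use IJ \<Lambda> in \<open>auto simp: J_def hull_inc divide_nonpos_pos\<close>)
      moreover have "J \<noteq> {}" using calculation by auto
      moreover have "(\<Sum>i\<in>I. real (nat (d i)) *\<^sub>R i) = real (\<Sum>i\<in>I. nat (d i)) *\<^sub>R x"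
      proof -
        have "real (nat (d i)) = real_of_int (d i)" if "i \<in> I" for i using that by (simp add: I_def)
        moreover have "(\<Sum>i\<in>I. real_of_int (d i)) = real_of_int \<Lambda>" by (simp add: \<Lambda>_def)
        ultimately show ?thesis using \<Lambda> by (simp add: x_def)
      qed
      ultimately have "(\<Sum>S\<in>Pow I. (-1) ^ card S * f (convex hull (J \<union> S))) = 0"
        using f IJ(3-6) \<open>I \<noteq> {}\<close> less.prems(3)
        by (intro weak_val_alternating_sum[where c = "\<lambda>i. nat (d i)" and x = x]) (auto simp: I_def)
      moreover have "f (convex hull (J \<union> S)) = 0" if "S \<in> Pow I - {I}" for S
      proof (rule less.hyps)
        have "J \<union> S \<subset> A" using that IJ by blast
        then show "card (J \<union> S) < card A" using less.prems psubset_card_mono by blast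
        show "finite (J \<union> S)" using \<open>J \<union> S \<subset> A\<close> less.prems(1) finite_subset[of "J \<union> S" A] by blast
        show "J \<union> S \<noteq> {}" using \<open>J \<noteq> {}\<close> by blast
        show "J \<union> S \<subseteq> int_lattice" using \<open>J \<union> S \<subset> A\<close> less.prems(3) by blast
      qed
      ultimately have "(-1) ^ card I * f (convex hull (J \<union> I)) = 0"
        using IJ(3) by (subst (asm) sum.remove[of _ I]) auto
      then show ?thesis using IJ(1) by (simp add: Un_commute)
    qed
  qed
  then show ?thesis using assms(2) by (auto elim!: lpolysE)
qed

subsection \<open>Polynomial sequences\<close>

text \<open>Degree below \<open>N\<close>, phrased through vanishing coefficients so that
  \<open>N = 0\<close> means the zero sequence, the start of the inductions on
  \<open>N\<close>.\<close>

definition poly_seq :: "nat \<Rightarrow> (nat \<Rightarrow> real) \<Rightarrow> bool" where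
  "poly_seq N F \<longleftrightarrow> (\<exists>p. (\<forall>k. F k = poly p (real k)) \<and> (\<forall>i\<ge>N. coeff p i = 0))"

definition interp :: "(nat \<Rightarrow> real) \<Rightarrow> real poly" where
  "interp F = (THE p. \<forall>k. F k = poly p (real k))"

definition at_neg1 :: "(nat \<Rightarrow> real) \<Rightarrow> real" where
  "at_neg1 F = poly (interp F) (-1)"

text \<open>The lower bound \<open>n\<close> serves identities that are known only for k \<ge> 1,
  where dilation by k is injective.\<close>

lemma poly_eq_if_eq_on_nat:
  fixes p q :: "real poly"
  assumes "\<And>k. k \<ge> n \<Longrightarrow> poly p (real k) = poly q (real k)"
  shows "p = q"
proof (rule ccontr)
  assume "p \<noteq> q"
  then have "finite {x. poly (p - q) x = 0}" by (intro poly_roots_finite) simp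
  moreover have "real ` {n..} \<subseteq> {x. poly (p - q) x = 0}" using assms by auto
  ultimately have "finite (real ` {n..})" by (rule rev_finite_subset)
  then show False by (simp add: finite_image_iff infinite_Ici)
qed

lemma interp_eqI: "(\<And>k. F k = poly p (real k)) \<Longrightarrow> interp F = p"
  unfolding interp_def by (rule the_equality) (auto intro: poly_eq_if_eq_on_nat[of 0])

lemma poly_seq_interp: "poly_seq N F \<Longrightarrow> F k = poly (interp F) (real k)"
  unfolding poly_seq_def using interp_eqI by metis

lemma poly_seq_coeff: "poly_seq N F \<Longrightarrow> i \<ge> N \<Longrightarrow> coeff (interp F) i = 0"
  unfolding poly_seq_def using interp_eqI by metis

lemma poly_seqI: "(\<And>k. F k = poly p (real k)) \<Longrightarrow> (\<And>i. i \<ge> N \<Longrightarrow> coeff p i = 0) \<Longrightarrow> poly_seq N F"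
  unfolding poly_seq_def by blast

lemma poly_seq_mono: "poly_seq M F \<Longrightarrow> M \<le> N \<Longrightarrow> poly_seq N F"
  unfolding poly_seq_def by (meson le_trans)

lemma
  assumes "poly_seq N F" "poly_seq M G"
  shows interp_add: "interp (\<lambda>k. F k + G k) = interp F + interp G"
    and interp_diff: "interp (\<lambda>k. F k - G k) = interp F - interp G"
    and interp_cmult: "interp (\<lambda>k. c * F k) = smult c (interp F)"
  using assms by (auto intro!: interp_eqI simp: poly_seq_interp)

lemma poly_seq_add: "poly_seq N F \<Longrightarrow> poly_seq N G \<Longrightarrow> poly_seq N (\<lambda>k. F k + G k)"
  by (rule poly_seqI[of _ "interp F + interp G"]) (auto simp: poly_seq_coeff poly_seq_interp)

lemma poly_seq_diff: "poly_seq N F \<Longrightarrow> poly_seq N G \<Longrightarrow> poly_seq N (\<lambda>k. F k - G k)"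
  by (rule poly_seqI[of _ "interp F - interp G"]) (auto simp: poly_seq_coeff poly_seq_interp)

lemma poly_seq_cmult: "poly_seq N F \<Longrightarrow> poly_seq N (\<lambda>k. c * F k)"
  by (auto intro!: poly_seqI[of _ "smult c (interp F)"] simp: poly_seq_coeff poly_seq_interp)

lemma poly_seq_zero: "poly_seq N (\<lambda>k. 0)"
  and interp_zero: "interp (\<lambda>k. 0) = 0"
  by (auto intro!: interp_eqI poly_seqI[of _ 0])

lemma poly_seq_sum: "(\<And>i. i \<in> I \<Longrightarrow> poly_seq N (F i)) \<Longrightarrow> poly_seq N (\<lambda>k. \<Sum>i\<in>I. F i k)"
  by (induction I rule: infinite_finite_induct) (auto intro: poly_seq_add poly_seq_zero)

lemma interp_sum: "(\<And>i. i \<in> I \<Longrightarrow> poly_seq N (F i)) \<Longrightarrow> interp (\<lambda>k. \<Sum>i\<in>I. F i k) = (\<Sum>i\<in>I. interp (F i))"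
proof (induction I rule: infinite_finite_induct)
  case (insert i I)
  then show ?case
    using interp_add[of N "F i" N "\<lambda>k. \<Sum>i\<in>I. F i k"] poly_seq_sum[of I N F] by simp
qed (auto simp: interp_zero)

lemma interp_shift: "poly_seq N F \<Longrightarrow> interp (\<lambda>k. F (Suc k)) = pcompose (interp F) [:1, 1:]"
  by (rule interp_eqI) (simp add: poly_pcompose poly_seq_interp add.commute)

text \<open>The shift moves the argument -1 to 0, so in a recursion for \<open>F (Suc k)\<close> the
  left-hand side turns into the known value \<open>F 0\<close>.\<close>

lemma at_neg1_shift: "poly_seq N F \<Longrightarrow> at_neg1 (\<lambda>k. F (Suc k)) = F 0"
  by (simp add: at_neg1_def interp_shift poly_pcompose poly_seq_interp[of N F 0])

lemma at_neg1_add: "poly_seq N F \<Longrightarrow> poly_seq M G \<Longrightarrow> at_neg1 (\<lambda>k. F k + G k) = at_neg1 F + at_neg1 G"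
  by (simp add: at_neg1_def interp_add)

lemma at_neg1_diff: "poly_seq N F \<Longrightarrow> poly_seq M G \<Longrightarrow> at_neg1 (\<lambda>k. F k - G k) = at_neg1 F - at_neg1 G"
  by (simp add: at_neg1_def interp_diff)

lemma at_neg1_sum: "(\<And>i. i \<in> I \<Longrightarrow> poly_seq N (F i)) \<Longrightarrow> at_neg1 (\<lambda>k. \<Sum>i\<in>I. F i k) = (\<Sum>i\<in>I. at_neg1 (F i))"
  unfolding at_neg1_def by (subst interp_sum) (auto simp: poly_sum)

section \<open>Forward differences characterise polynomial sequences\<close>

definition forward_diff :: "(nat \<Rightarrow> real) \<Rightarrow> nat \<Rightarrow> real" where
  "forward_diff F = (\<lambda>k. F (Suc k) - F k)"

lemma coeff_binomial_minus_monom: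
  "coeff ([:1, 1:] ^ n - monom 1 n :: real poly) i = (if i < n then real (n choose i) else 0)"
proof (cases "i \<le> n")
  case False
  then show ?thesis by (simp add: coeff_eq_0 degree_linear_power)
qed (auto simp: coeff_linear_poly_power)

lemma poly_antidifference:
  fixes q :: "real poly"
  assumes "\<forall>i\<ge>N. coeff q i = 0"
  shows "\<exists>p. (\<forall>i\<ge>Suc N. coeff p i = 0) \<and> (\<forall>x. poly p (x + 1) - poly p x = poly q x)"
  using assms
proof (induction N arbitrary: q)
  case 0
  then have "q = 0" by (simp add: poly_eq_iff)
  then show ?case by (intro exI[of _ 0]) simp
next
  case (Suc N)
  \<comment> \<open>The difference of x^(N+1) has leading coefficient N + 1, so this multiple
    cancels the top coefficient of \<open>q\<close>.\<close>
  define c where "c = coeff q N / real (Suc N)"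
  define d where "d = smult c ([:1, 1:] ^ Suc N - monom 1 (Suc N))"
  have d: "coeff d i = (if i < Suc N then c * real (Suc N choose i) else 0)" for i
    unfolding d_def coeff_smult coeff_binomial_minus_monom by simp
  have "\<forall>i\<ge>N. coeff (q - d) i = 0"
  proof (intro allI impI)
    fix i assume "N \<le> i"
    then show "coeff (q - d) i = 0"
      using Suc.prems by (cases "i = N") (auto simp: d c_def)
  qed
  from Suc.IH[OF this] obtain p where p: "\<forall>i\<ge>Suc N. coeff p i = 0"
    "\<forall>x. poly p (x + 1) - poly p x = poly (q - d) x" by blast
  have "poly (p + monom c (Suc N)) (x + 1) - poly (p + monom c (Suc N)) x = poly q x" for x
    using p(2)[rule_format, of x] by (simp add: d_def poly_monom algebra_simps)
  moreover have "\<forall>i\<ge>Suc (Suc N). coeff (p + monom c (Suc N)) i = 0" using p(1) by simp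
  ultimately show ?case by blast
qed

lemma poly_seq_antidifference:
  assumes "poly_seq N (forward_diff F)"
  shows "poly_seq (Suc N) F"
proof -
  obtain p where p: "\<forall>i\<ge>Suc N. coeff p i = 0"
    "\<forall>x. poly p (x + 1) - poly p x = poly (interp (forward_diff F)) x"
    using poly_antidifference[of N "interp (forward_diff F)"] poly_seq_coeff[OF assms] by blast
  have "F k = poly (p + [:F 0 - poly p 0:]) (real k)" for k
  proof (induction k)
    case (Suc k)
    have "F (Suc k) = F k + poly (interp (forward_diff F)) (real k)"
      using poly_seq_interp[OF assms, of k] by (simp add: forward_diff_def)
    then show ?case using p(2)[rule_format, of "real k"] Suc.IH by (simp add: add.commute)
  qed simp
  moreover have "coeff (p + [:F 0 - poly p 0:]) i = 0" if "i \<ge> Suc N" for i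
    using that p(1) by (cases i) auto
  ultimately show ?thesis by (rule poly_seqI)
qed

lemma poly_eq_sum_coeff:
  fixes p :: "real poly"
  assumes "degree p \<le> N"
  shows "poly p x = (\<Sum>i\<le>N. coeff p i * x ^ i)"
  using arg_cong[OF poly_as_sum_of_monoms'[OF assms], of "\<lambda>p. poly p x"] by (simp add: poly_sum poly_monom)

lemma poly_seq_forward_diff:
  assumes "poly_seq (Suc N) F"
  shows "poly_seq N (forward_diff F)"
proof (rule poly_seqI)
  define p where "p = interp F"
  define q where "q = (\<Sum>i\<le>N. smult (coeff p i) ([:1, 1:] ^ i - monom 1 i))"
  have "degree p \<le> N"
    using poly_seq_coeff[OF assms] by (intro degree_le) (auto simp: p_def)
  then have p: "poly p x = (\<Sum>i\<le>N. coeff p i * x ^ i)" for x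
    by (rule poly_eq_sum_coeff)
  show "forward_diff F k = poly q (real k)" for k
    unfolding forward_diff_def poly_seq_interp[OF assms] p_def[symmetric] p q_def
    by (simp add: poly_sum poly_monom sum_subtractf[symmetric] algebra_simps)
  show "coeff q i = 0" if "i \<ge> N" for i
    using that by (simp add: q_def coeff_sum coeff_binomial_minus_monom del: coeff_diff)
qed

text \<open>This turns polynomiality into equations that are linear in \<open>F\<close>, one for
  each \<open>k\<close>, and hence into the vanishing of valuations.\<close>

lemma poly_seq_iff_forward_diff: "poly_seq N F \<longleftrightarrow> (\<forall>k. (forward_diff ^^ N) F k = 0)"
proof (induction N arbitrary: F)
  case 0
  show ?case
    by (auto simp: poly_seq_def poly_eq_iff[symmetric] intro: exI[of _ 0])
      (metis coeff_0 poly_0 poly_eqI)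
next
  case (Suc N)
  have "poly_seq (Suc N) F \<longleftrightarrow> poly_seq N (forward_diff F)"
    using poly_seq_antidifference poly_seq_forward_diff by blast
  then show ?case by (simp add: Suc.IH funpow_Suc_right del: funpow.simps)
qed

subsection \<open>Dissecting dilates\<close>

text \<open>A discrete form of being polynomial of degree below \<open>m\<close> under lattice
  translations. The recursive form supports induction on \<open>m\<close>, since a translation
  difference has order one less.\<close>

primrec transl_poly :: "nat \<Rightarrow> ((real ^ 'n::finite) set \<Rightarrow> real) \<Rightarrow> bool" where
  "transl_poly 0 f \<longleftrightarrow> (\<forall>P\<in>lpolys. f P = 0)"
| "transl_poly (Suc m) f \<longleftrightarrow> (\<forall>y\<in>int_lattice. transl_poly m (\<lambda>P. f ({y} + P) - f P))"

lemma transl_poly_plus: "transl_poly m f \<Longrightarrow> K \<in> lpolys \<Longrightarrow> transl_poly m (\<lambda>P. f (K + P))"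
proof (induction m arbitrary: f)
  case (Suc m)
  have "transl_poly m (\<lambda>P. f (K + ({y} + P)) - f (K + P))" if "y \<in> int_lattice" for y
    using Suc.IH[of "\<lambda>P. f ({y} + P) - f P"] Suc.prems that by (simp add: add.left_commute)
  then show ?case by simp
qed (simp add: lpolys_plus)

lemma convex_hull_product_image:
  fixes v :: "'b \<Rightarrow> real ^ 'n::finite"
  shows "convex hull ((\<lambda>(a, b). v a + c *\<^sub>R v b) ` (X \<times> Y))
    = convex hull (v ` X) + (*\<^sub>R) c ` (convex hull (v ` Y))"
proof -
  have "(\<lambda>(a, b). v a + c *\<^sub>R v b) ` (X \<times> Y) = v ` X + (*\<^sub>R) c ` v ` Y"
    by (force simp: set_plus_def)
  then show ?thesis by (simp add: convex_hull_set_plus convex_hull_scaling)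
qed

text \<open>In the coordinates in which a simplex \<open>convex hull (v ` {p..q})\<close> is \<open>1 \<ge> x\<^sub>1 \<ge> \<dots> \<ge> x\<^sub>d \<ge> 0\<close>, the dilate by \<open>k + 1\<close>
  is cut along the hyperplanes \<open>x\<^sub>i = k\<close>.\<close>

lemma weak_val_dissect:
  fixes v :: "nat \<Rightarrow> real ^ 'n::finite"
  assumes f: "weak_val f" and v: "\<And>i. i \<in> {p..q} \<Longrightarrow> v i \<in> int_lattice" and "p \<le> q"
  shows "f ((*\<^sub>R) (real (Suc k)) ` (convex hull (v ` {p..q})))
    = (\<Sum>i\<in>{p..q}. f (convex hull (v ` {p..i}) + (*\<^sub>R) (real k) ` (convex hull (v ` {i..q}))))
    - (\<Sum>i\<in>{p..<q}. f (convex hull (v ` {p..i}) + (*\<^sub>R) (real k) ` (convex hull (v ` {Suc i..q}))))"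
proof -
  define pt where "pt = (\<lambda>(a, b). v a + real k *\<^sub>R v b)"
  \<comment> \<open>\<open>R i\<close> is what remains of the dilate by k + 1 after the slabs with
    index below \<open>i\<close> are cut off: \<open>R p\<close> is the whole dilate,
    \<open>R q\<close> the last slab.\<close>
  define R where "R = (\<lambda>i. convex hull (pt ` {(a, b). p \<le> a \<and> a \<le> b \<and> b \<le> q \<and> i \<le> b}))"
  have pt_mem: "pt (a, b) \<in> (*\<^sub>R) (real (Suc k)) ` (convex hull (v ` X))" if "a \<in> X" "b \<in> X" for a b X
  proof -
    have "(1 / real (Suc k)) *\<^sub>R v a + (real k / real (Suc k)) *\<^sub>R v b \<in> convex hull (v ` X)"
      using that by (intro convexD) (auto intro: hull_inc simp: add_divide_distrib[symmetric])
    moreover have "pt (a, b) = real (Suc k) *\<^sub>R ((1 / real (Suc k)) *\<^sub>R v a + (real k / real (Suc k)) *\<^sub>R v b)"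
      by (simp add: pt_def scaleR_right_distrib del: of_nat_Suc)
    ultimately show ?thesis by blast
  qed
  have pt_hull: "convex hull (pt ` I) \<subseteq> (*\<^sub>R) (real (Suc k)) ` (convex hull (v ` X))" if "I \<subseteq> X \<times> X" for I X
    using that by (intro hull_minimal convex_scaling convex_convex_hull) (auto intro: pt_mem simp del: of_nat_Suc)
  have pt_int: "pt ` I \<subseteq> int_lattice" if "I \<subseteq> {p..q} \<times> {p..q}" for I
    using that v by (force simp: pt_def intro!: int_lattice_add int_lattice_scale)
  have R_step: "f (R i) = f (convex hull (v ` {p..i}) + (*\<^sub>R) (real k) ` (convex hull (v ` {i..q}))) + f (R (Suc i))
      - f (convex hull (v ` {p..i}) + (*\<^sub>R) (real k) ` (convex hull (v ` {Suc i..q})))" if i: "p \<le> i" "i < q" for i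
  proof -
    define A where "A = {p..i} \<times> {i}"
    define B where "B = {(a, b). i < a \<and> a \<le> b \<and> b \<le> q}"
    define C where "C = {p..i} \<times> {Suc i..q}"
    have fin: "finite A" "finite B" "finite C"
      unfolding A_def B_def C_def by (auto intro: finite_subset[of _ "{..q} \<times> {..q}"])
    have "A \<union> B \<union> C \<subseteq> {p..q} \<times> {p..q}" "C \<noteq> {}"
      using i by (auto simp: A_def B_def C_def)
    note int = pt_int[OF this(1)] and C = this(2)
    \<comment> \<open>Points of the two hulls have the forms (k+1) x' and (k+1) y'. The ratio
      k/(k+1) mixes them to x' + k y', a point of the Minkowski sum spanned by
      \<open>C\<close>.\<close>
    have cross: "(1 - real k / real (Suc k)) *\<^sub>R x + (real k / real (Suc k)) *\<^sub>R y \<in> convex hull (pt ` C)"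
      if x: "x \<in> convex hull (pt ` A)" and y: "y \<in> convex hull (pt ` B)" for x y
    proof -
      have "A \<subseteq> {p..i} \<times> {p..i}" "B \<subseteq> {Suc i..q} \<times> {Suc i..q}"
        using i by (auto simp: A_def B_def)
      note hull = this[THEN pt_hull]
      obtain x' where x': "x' \<in> convex hull (v ` {p..i})" "x = real (Suc k) *\<^sub>R x'"
        using hull(1) x by blast
      obtain y' where y': "y' \<in> convex hull (v ` {Suc i..q})" "y = real (Suc k) *\<^sub>R y'"
        using hull(2) y by blast
      have "(1 - real k / real (Suc k)) * real (Suc k) = 1" by (simp add: field_simps)
      then have "(1 - real k / real (Suc k)) *\<^sub>R x + (real k / real (Suc k)) *\<^sub>R y = x' + real k *\<^sub>R y'"
        by (simp add: x' y' del: of_nat_Suc)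
      also have "\<dots> \<in> convex hull (pt ` C)"
        unfolding C_def pt_def convex_hull_product_image using x'(1) y'(1) by (intro set_plus_intro) auto
      finally show ?thesis .
    qed
    have "f (convex hull (pt ` A \<union> pt ` B \<union> pt ` C))
        = f (convex hull (pt ` A \<union> pt ` C)) + f (convex hull (pt ` B \<union> pt ` C)) - f (convex hull (pt ` C))"
      using fin int C by (intro weak_val_cut[OF f _ _ _ _ _ _ _ cross]) (auto simp: image_Un)
    moreover have "pt ` A \<union> pt ` C = pt ` ({p..i} \<times> {i..q})"
      using i by (auto simp: A_def C_def image_Un[symmetric] intro!: arg_cong[where f = "image pt"])
    moreover have "pt ` B \<union> pt ` C = pt ` {(a, b). p \<le> a \<and> a \<le> b \<and> b \<le> q \<and> Suc i \<le> b}"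
      using i by (auto simp: B_def C_def image_Un[symmetric] intro!: arg_cong[where f = "image pt"])
    moreover have "pt ` A \<union> pt ` B \<union> pt ` C = pt ` {(a, b). p \<le> a \<and> a \<le> b \<and> b \<le> q \<and> i \<le> b}"
      using i by (auto simp: A_def B_def C_def image_Un[symmetric] intro!: arg_cong[where f = "image pt"])
    ultimately show ?thesis
      by (simp add: R_def C_def pt_def convex_hull_product_image)
  qed
  have R_q: "R q = convex hull (v ` {p..q}) + (*\<^sub>R) (real k) ` (convex hull (v ` {q..q}))"
  proof -
    have "{(a, b). p \<le> a \<and> a \<le> b \<and> b \<le> q \<and> q \<le> b} = {p..q} \<times> {q..q}" using \<open>p \<le> q\<close> by auto
    then show ?thesis by (simp only: R_def pt_def convex_hull_product_image)
  qed
  have sum: "f (R i) = (\<Sum>j\<in>{i..q}. f (convex hull (v ` {p..j}) + (*\<^sub>R) (real k) ` (convex hull (v ` {j..q}))))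
    - (\<Sum>j\<in>{i..<q}. f (convex hull (v ` {p..j}) + (*\<^sub>R) (real k) ` (convex hull (v ` {Suc j..q}))))"
    if "i \<le> q" "p \<le> i" for i
    using that
  proof (induction rule: inc_induct)
    case base
    then show ?case by (simp add: R_q)
  next
    case (step i)
    then show ?case
      using R_step[of i]
      by (simp add: sum.atLeast_Suc_atMost sum.atLeast_Suc_lessThan)
  qed
  have "R p = (*\<^sub>R) (real (Suc k)) ` (convex hull (v ` {p..q}))"
  proof (rule equalityI)
    show "R p \<subseteq> (*\<^sub>R) (real (Suc k)) ` (convex hull (v ` {p..q}))"
      unfolding R_def by (rule pt_hull) auto
    have "(*\<^sub>R) (real (Suc k)) ` v ` {p..q} \<subseteq> pt ` {(a, b). p \<le> a \<and> a \<le> b \<and> b \<le> q \<and> p \<le> b}"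
    proof
      fix x assume "x \<in> (*\<^sub>R) (real (Suc k)) ` v ` {p..q}"
      then obtain a where "a \<in> {p..q}" "x = pt (a, a)" by (auto simp: pt_def scaleR_left_distrib)
      then show "x \<in> pt ` {(a, b). p \<le> a \<and> a \<le> b \<and> b \<le> q \<and> p \<le> b}" by auto
    qed
    then show "(*\<^sub>R) (real (Suc k)) ` (convex hull (v ` {p..q})) \<subseteq> R p"
      unfolding R_def convex_hull_scaling[symmetric] by (rule hull_mono)
  qed
  then show ?thesis using sum[of p] \<open>p \<le> q\<close> by simp
qed

section \<open>Polynomiality in the dilation factor\<close>

lemma lpolys_hull_interval:
  fixes v :: "nat \<Rightarrow> real ^ 'n::finite"
  shows "(\<And>i. i \<in> {p..q} \<Longrightarrow> v i \<in> int_lattice) \<Longrightarrow> p \<le> q \<Longrightarrow> convex hull (v ` {p..q}) \<in> lpolys"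
  by (intro lpolysI) auto

lemma weak_val_transl_diff:
  "weak_val f \<Longrightarrow> y \<in> int_lattice \<Longrightarrow> weak_val (\<lambda>P. f ({y} + P) - f P)"
  by (intro weak_val_diff weak_val_plus lpolys_singleton)

text \<open>Outer induction on the dimension for all \<open>f\<close> and \<open>m\<close>, inner
  induction on \<open>m\<close>. In the dissection of (k+1)T the only full-dimensional dilate
  appears translated by \<open>v p\<close>; subtracting f(kT) leaves a translation difference, of
  order \<open>m\<close> instead of \<open>Suc m\<close>. In all other terms the fixed summand is
  absorbed into \<open>f\<close>, and the smaller dimension of the dilated simplex makes up for the
  unreduced order.\<close>

lemma poly_seq_dilate_hull:
  fixes v :: "nat \<Rightarrow> real ^ 'n::finite"
  assumes "weak_val f" "transl_poly m f" and "\<And>i. i \<in> {p..q} \<Longrightarrow> v i \<in> int_lattice" and "p \<le> q"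
  shows "poly_seq (m + (q - p)) (\<lambda>k. f ((*\<^sub>R) (real k) ` (convex hull (v ` {p..q}))))"
  using assms
proof (induction "q - p" arbitrary: p q f m rule: less_induct)
  case (less p q)
  note dims = less.hyps and v = less.prems(3) and pq = less.prems(4)
  have "poly_seq (m + (q - p)) (\<lambda>k. f ((*\<^sub>R) (real k) ` (convex hull (v ` {p..q}))))"
    if "weak_val f" "transl_poly m f" for f m
    using that
  proof (induction m arbitrary: f)
    case 0
    then have "f ((*\<^sub>R) (real k) ` (convex hull (v ` {p..q}))) = 0" for k
      using lpolys_scale[OF lpolys_hull_interval[of p q v], of "real k"] v pq by simp
    then show ?case by (simp add: poly_seq_zero)
  next
    case (Suc m)
    let ?T = "\<lambda>i j. convex hull (v ` {i..j})"
    let ?F = "\<lambda>k. f ((*\<^sub>R) (real k) ` ?T p q)"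
    have "poly_seq (m + (q - p)) (\<lambda>k. f ({v p} + (*\<^sub>R) (real k) ` ?T p q) - f ((*\<^sub>R) (real k) ` ?T p q))"
      using Suc v[of p] pq by (intro Suc.IH weak_val_transl_diff) auto
    moreover have "poly_seq (m + (q - p)) (\<lambda>k. f (?T p i + (*\<^sub>R) (real k) ` ?T i q))"
      if i: "i \<in> {Suc p..q}" for i
    proof (rule poly_seq_mono)
      show "poly_seq (Suc m + (q - i)) (\<lambda>k. f (?T p i + (*\<^sub>R) (real k) ` ?T i q))"
        using i Suc.prems v by (intro dims weak_val_plus transl_poly_plus lpolys_hull_interval) auto
    qed (use i in auto)
    moreover have "poly_seq (m + (q - p)) (\<lambda>k. f (?T p i + (*\<^sub>R) (real k) ` ?T (Suc i) q))"
      if i: "i \<in> {p..<q}" for i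
    proof (rule poly_seq_mono)
      show "poly_seq (Suc m + (q - Suc i)) (\<lambda>k. f (?T p i + (*\<^sub>R) (real k) ` ?T (Suc i) q))"
        using i Suc.prems v by (intro dims weak_val_plus transl_poly_plus lpolys_hull_interval) auto
    qed (use i in auto)
    ultimately have "poly_seq (m + (q - p)) (\<lambda>k.
        (f ({v p} + (*\<^sub>R) (real k) ` ?T p q) - f ((*\<^sub>R) (real k) ` ?T p q))
        + (\<Sum>i\<in>{Suc p..q}. f (?T p i + (*\<^sub>R) (real k) ` ?T i q))
        - (\<Sum>i\<in>{p..<q}. f (?T p i + (*\<^sub>R) (real k) ` ?T (Suc i) q)))"
      by (intro poly_seq_diff[OF poly_seq_add] poly_seq_sum)
    moreover have "forward_diff ?F = (\<lambda>k.
        (f ({v p} + (*\<^sub>R) (real k) ` ?T p q) - f ((*\<^sub>R) (real k) ` ?T p q))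
        + (\<Sum>i\<in>{Suc p..q}. f (?T p i + (*\<^sub>R) (real k) ` ?T i q))
        - (\<Sum>i\<in>{p..<q}. f (?T p i + (*\<^sub>R) (real k) ` ?T (Suc i) q)))"
      unfolding forward_diff_def
      by (rule ext, subst weak_val_dissect) (use Suc.prems v pq in \<open>auto simp: sum.atLeast_Suc_atMost\<close>)
    ultimately have "poly_seq (m + (q - p)) (forward_diff ?F)" by (simp only:)
    then show ?case by (simp add: poly_seq_antidifference)
  qed
  then show ?case using less.prems by blast
qed

lemma weak_val_forward_diff:
  "(\<And>k. weak_val (\<lambda>P. F P k)) \<Longrightarrow> weak_val (\<lambda>P. (forward_diff ^^ N) (F P) k)"
proof (induction N arbitrary: k)
  case (Suc N)
  then show ?case by (simp add: forward_diff_def weak_val_diff)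
qed simp

lemma poly_seq_dilate_simplex:
  fixes A :: "(real ^ 'n::finite) set"
  assumes "weak_val f" "transl_poly m f" and A: "finite A" "A \<noteq> {}" "A \<subseteq> int_lattice" "\<not> affine_dependent A"
  shows "poly_seq (m + CARD('n)) (\<lambda>k. f ((*\<^sub>R) (real k) ` (convex hull A)))"
proof -
  obtain v where v: "bij_betw v {0..<card A} A" using ex_bij_betw_nat_finite[OF A(1)] by blast
  have card: "card A > 0" using A by (simp add: card_gt_0_iff)
  then have "{0..<card A} = {0..card A - 1}" by auto
  with v have vA: "v ` {0..card A - 1} = A" by (simp add: bij_betw_def)
  have "int (card A) - 1 = aff_dim A" using A(4) by (simp add: aff_dim_affine_independent)
  also have "\<dots> \<le> CARD('n)" using aff_dim_le_DIM[of A] by simp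
  finally have "card A - 1 \<le> CARD('n)" by linarith
  have "poly_seq (m + (card A - 1 - 0)) (\<lambda>k. f ((*\<^sub>R) (real k) ` (convex hull (v ` {0..card A - 1}))))"
    using assms vA by (intro poly_seq_dilate_hull) auto
  then show ?thesis unfolding vA by (rule poly_seq_mono) (use \<open>card A - 1 \<le> CARD('n)\<close> in simp)
qed

text \<open>At a fixed \<open>k\<close>, the iterated forward difference of the dilate sequence is
  itself a valuation in \<open>P\<close>, so its vanishing on simplices suffices.\<close>

lemma poly_seq_dilate:
  fixes P :: "(real ^ 'n::finite) set"
  assumes "weak_val f" "transl_poly m f" "P \<in> lpolys"
  shows "poly_seq (m + CARD('n)) (\<lambda>k. f ((*\<^sub>R) (real k) ` P))"
  unfolding poly_seq_iff_forward_diff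
proof
  fix k
  show "(forward_diff ^^ (m + CARD('n))) (\<lambda>k. f ((*\<^sub>R) (real k) ` P)) k = 0"
  proof (rule weak_val_zero_if_zero_on_simplices[OF _ assms(3)])
    show "weak_val (\<lambda>P. (forward_diff ^^ (m + CARD('n))) (\<lambda>k. f ((*\<^sub>R) (real k) ` P)) k)"
      using assms(1) by (intro weak_val_forward_diff weak_val_scale) auto
    show "(forward_diff ^^ (m + CARD('n))) (\<lambda>k. f ((*\<^sub>R) (real k) ` (convex hull A))) k = 0"
      if "finite A" "A \<noteq> {}" "A \<subseteq> int_lattice" "\<not> affine_dependent A" for A :: "(real ^ 'n) set"
      using poly_seq_dilate_simplex[OF assms(1,2) that] by (simp add: poly_seq_iff_forward_diff)
  qed
qed

subsection \<open>Reciprocity for the dilates of a list of points\<close>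

text \<open>The generating differences v a - v b split into those with b = i, those with a = i, and
  the rest; 0 comes from a = b = i. Adding v a - v i and v i - v b gives a difference of the third
  kind, so the midpoint of the two lies halfway between 0 and that point. This is why the ratio is
  1/2 and why 0 belongs to the separating set.\<close>

lemma weak_val_cut_difference_body:
  fixes v :: "nat \<Rightarrow> real ^ 'n::finite" and i :: nat
  assumes f: "weak_val f" and v: "\<And>j. j \<in> {p..q} \<Longrightarrow> v j \<in> int_lattice" and i: "i \<in> {p..q}" and S: "S \<subseteq> {Suc i..q}"
  defines "W \<equiv> \<lambda>j S. f (convex hull (insert 0 ((\<lambda>(a, b). v a - v b) ` ({p..<j} \<times> S))))"
  shows "f (convex hull (v ` {p..i}) + uminus ` (convex hull (v ` insert i S)))
    = W i (insert i S) + W (Suc i) S - W i S"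
proof -
  let ?d = "\<lambda>(a, b). v a - v b"
  define A where "A = {p..<i} \<times> {i}"
  define B where "B = {i} \<times> S"
  define C where "C = {p..<i} \<times> S"
  have S': "finite S" "S \<subseteq> {p..q}" using S i finite_subset by auto
  have d_int: "?d ` I \<subseteq> int_lattice" if "I \<subseteq> {p..q} \<times> {p..q}" for I
    using that v by (force intro: int_lattice_diff)
  have cross: "(1 - 1 / 2) *\<^sub>R x + (1 / 2 :: real) *\<^sub>R y \<in> convex hull (insert 0 (?d ` C))"
    if "x \<in> convex hull (?d ` A)" "y \<in> convex hull (?d ` B)" for x y
  proof -
    have "x + y \<in> convex hull (?d ` A) + convex hull (?d ` B)"
      using that by (rule set_plus_intro)
    also have "\<dots> = convex hull (?d ` A + ?d ` B)" by (simp add: convex_hull_set_plus)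
    also have "\<dots> \<subseteq> convex hull (insert 0 (?d ` C))"
      by (intro hull_mono) (force simp: A_def B_def C_def set_plus_def)
    finally have "x + y \<in> convex hull (insert 0 (?d ` C))" .
    then have "(1 / 2 :: real) *\<^sub>R 0 + (1 / 2 :: real) *\<^sub>R (x + y) \<in> convex hull (insert 0 (?d ` C))"
      by (intro convexD) (auto intro: hull_inc)
    then show ?thesis by (simp add: scaleR_right_distrib)
  qed
  have "A \<union> B \<union> C \<subseteq> {p..q} \<times> {p..q}" using S' i by (auto simp: A_def B_def C_def)
  from d_int[OF this] have "f (convex hull (?d ` A \<union> ?d ` B \<union> insert 0 (?d ` C)))
      = f (convex hull (?d ` A \<union> insert 0 (?d ` C))) + f (convex hull (?d ` B \<union> insert 0 (?d ` C)))
        - f (convex hull (insert 0 (?d ` C)))"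
    using S'(1) by (intro weak_val_cut[OF f _ _ _ _ _ _ _ cross])
      (auto simp: image_Un int_lattice_zero A_def B_def C_def)
  moreover have "?d ` A \<union> insert 0 (?d ` C) = insert 0 (?d ` ({p..<i} \<times> insert i S))"
  proof -
    have "{p..<i} \<times> insert i S = A \<union> C" by (auto simp: A_def C_def)
    then show ?thesis by (simp add: image_Un)
  qed
  moreover have "?d ` B \<union> insert 0 (?d ` C) = insert 0 (?d ` ({p..<Suc i} \<times> S))"
  proof -
    have "{p..<Suc i} \<times> S = B \<union> C" using i by (auto simp: B_def C_def)
    then show ?thesis by (simp add: image_Un)
  qed
  moreover have "convex hull (v ` {p..i}) + uminus ` (convex hull (v ` insert i S))
      = convex hull (?d ` A \<union> ?d ` B \<union> insert 0 (?d ` C))"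
  proof -
    have "uminus ` (convex hull (v ` insert i S)) = (*\<^sub>R) (-1) ` (convex hull (v ` insert i S))" by simp
    then have "convex hull (v ` {p..i}) + uminus ` (convex hull (v ` insert i S))
      = convex hull ((\<lambda>(a, b). v a + (-1) *\<^sub>R v b) ` ({p..i} \<times> insert i S))"
      by (simp only: convex_hull_product_image)
    also have "(\<lambda>(a, b). v a + (-1) *\<^sub>R v b) ` ({p..i} \<times> insert i S) = ?d ` ({p..i} \<times> insert i S)" by auto
    also have "{p..i} \<times> insert i S = A \<union> B \<union> insert (i, i) C"
      using i by (auto simp: A_def B_def C_def)
    finally show ?thesis by (simp add: image_Un)
  qed
  ultimately show ?thesis by (simp add: W_def C_def)
qed

text \<open>Cutting the polytope in each summand by the preceding lemma makes the sum telescope.\<close>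

lemma sum_difference_body:
  fixes v :: "nat \<Rightarrow> real ^ 'n::finite"
  assumes f: "weak_val f" and v: "\<And>j. j \<in> {p..q} \<Longrightarrow> v j \<in> int_lattice" and pq: "p \<le> q"
  shows "(\<Sum>i\<in>{p..q}. \<Sum>S\<in>Pow {Suc i..q}. (-1) ^ card S *
      f (convex hull (v ` {p..i}) + uminus ` (convex hull (v ` insert i S)))) = f {0}"
proof -
  define W where "W = (\<lambda>j S. f (convex hull (insert 0 ((\<lambda>(a, b). v a - v b) ` ({p..<j} \<times> S)))))"
  \<comment> \<open>In the signed sum of the three-term cuts, the terms
    \<open>W i (insert i S)\<close> and \<open>W i S\<close> combine to minus the sum over
    \<open>Pow {i..q}\<close>, so index \<open>i\<close> contributes
    \<open>V (Suc i) - V i\<close>.\<close>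
  define V where "V = (\<lambda>i. \<Sum>S\<in>Pow {i..q}. (-1) ^ card S * W i S)"
  have card: "card (insert i S) = Suc (card S)" if "S \<in> Pow {Suc i..q}" for i S
    using that finite_subset[of S "{Suc i..q}"] by (subst card_insert_disjoint) auto
  have split: "(\<Sum>S\<in>Pow {i..q}. (-1) ^ card S * g S)
      = (\<Sum>S\<in>Pow {Suc i..q}. (-1) ^ card S * g S) - (\<Sum>S\<in>Pow {Suc i..q}. (-1) ^ card S * g (insert i S))"
    if "i \<le> q" for i and g :: "nat set \<Rightarrow> real"
  proof -
    have "{i..q} = insert i {Suc i..q}" using that by auto
    then show ?thesis
      by (simp add: sum_Pow_insert card sum_negf del: Pow_iff cong: sum.cong)
  qed
  have "(\<Sum>S\<in>Pow {Suc i..q}. (-1) ^ card S *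
      f (convex hull (v ` {p..i}) + uminus ` (convex hull (v ` insert i S)))) = V (Suc i) - V i"
    if "i \<in> {p..q}" for i
  proof -
    have "(\<Sum>S\<in>Pow {Suc i..q}. (-1) ^ card S *
      f (convex hull (v ` {p..i}) + uminus ` (convex hull (v ` insert i S))))
      = (\<Sum>S\<in>Pow {Suc i..q}. (-1) ^ card S * (W i (insert i S) + W (Suc i) S - W i S))"
      using weak_val_cut_difference_body[OF f v that] by (intro sum.cong) (auto simp: W_def)
    also have "\<dots> = V (Suc i) - V i"
      using that split[of i "W i"] by (simp add: V_def algebra_simps sum.distrib sum_subtractf)
    finally show ?thesis .
  qed
  then have "(\<Sum>i\<in>{p..q}. \<Sum>S\<in>Pow {Suc i..q}. (-1) ^ card S *
      f (convex hull (v ` {p..i}) + uminus ` (convex hull (v ` insert i S))))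
    = (\<Sum>i\<in>{p..<Suc q}. V (Suc i) - V i)"
    by (intro sum.cong) auto
  also have "\<dots> = V (Suc q) - V p" using pq by (intro sum_Suc_diff') simp
  also have "V (Suc q) = f {0}" by (simp add: V_def W_def)
  \<comment> \<open>No index lies in \<open>{p..<p}\<close>, so \<open>W p S\<close> is
    \<open>f {0}\<close> for every \<open>S\<close>, and its alternating sum over the subsets of a
    nonempty set vanishes.\<close>
  also have "V p = 0" using split[OF pq, of "W p"] by (simp add: V_def W_def)
  finally show ?thesis by simp
qed

text \<open>The dissection is an identity between polynomials in \<open>k\<close> and is evaluated at \<open>k = -1\<close>: the
  left-hand side becomes \<open>f {0}\<close>, the terms with lower-dimensional second summand are known by
  induction, and what remains is the claim for the translate of \<open>f\<close> by \<open>v p\<close>.\<close>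

lemma at_neg1_dilate_hull:
  fixes v :: "nat \<Rightarrow> real ^ 'n::finite"
  assumes "weak_val f" "transl_poly m f" and "\<And>i. i \<in> {p..q} \<Longrightarrow> v i \<in> int_lattice" and "p \<le> q"
  shows "at_neg1 (\<lambda>k. f ((*\<^sub>R) (real k) ` (convex hull (v ` {p..q}))))
    = (\<Sum>S\<in>Pow {p..q} - {{}}. (-1) ^ Suc (card S) * f (uminus ` (convex hull (v ` S))))"
  using assms
proof (induction "q - p" arbitrary: p q f rule: less_induct)
  case (less p q)
  note dims = less.hyps and v = less.prems(3) and pq = less.prems(4)
  let ?T = "\<lambda>i j. convex hull (v ` {i..j})"
  have shifted: "at_neg1 (\<lambda>k. f ({v p} + (*\<^sub>R) (real k) ` ?T p q))
    = (\<Sum>S\<in>Pow {p..q} - {{}}. (-1) ^ Suc (card S) * f ({v p} + uminus ` (convex hull (v ` S))))"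
    if f: "weak_val f" "transl_poly m f" for f
  proof -
    define g where "g = (\<lambda>i S. f (?T p i + uminus ` (convex hull (v ` S))))"
    define c where "c = (\<lambda>i X. \<Sum>S\<in>Pow X - {{}}. (-1) ^ Suc (card S) * g i S)"
    have hull: "convex hull (v ` {i..j}) \<in> lpolys" if "p \<le> i" "i \<le> j" "j \<le> q" for i j
      using v that by (intro lpolys_hull_interval) auto
    have h: "weak_val (\<lambda>P. f (?T p i + P))" "transl_poly m (\<lambda>P. f (?T p i + P))" if "i \<in> {p..q}" for i
      using that f hull by (auto intro: weak_val_plus transl_poly_plus)
    have poly: "poly_seq (m + CARD('n)) (\<lambda>k. f (?T p i + (*\<^sub>R) (real k) ` ?T j q))"
      if "i \<in> {p..q}" "j \<in> {p..q}" for i j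
      using h[OF that(1)] hull[of j q] that(2) by (intro poly_seq_dilate) auto
    have IH: "at_neg1 (\<lambda>k. f (?T p i + (*\<^sub>R) (real k) ` ?T j q)) = c i {j..q}"
      if "i \<in> {p..q}" "j \<in> {Suc p..q}" for i j
      unfolding c_def g_def using h[OF that(1)] that(2) v by (intro dims) auto
    have "f {0} = f ((*\<^sub>R) (real 0) ` ?T p q)" using pq by (simp add: image_constant_conv)
    also have "\<dots> = at_neg1 (\<lambda>k. f ((*\<^sub>R) (real (Suc k)) ` ?T p q))"
      using poly_seq_dilate[OF f hull[of p q]] pq by (subst at_neg1_shift) auto
    also have "(\<lambda>k. f ((*\<^sub>R) (real (Suc k)) ` ?T p q)) = (\<lambda>k.
        (f ({v p} + (*\<^sub>R) (real k) ` ?T p q)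
        + (\<Sum>i\<in>{Suc p..q}. f (?T p i + (*\<^sub>R) (real k) ` ?T i q)))
        - (\<Sum>i\<in>{p..<q}. f (?T p i + (*\<^sub>R) (real k) ` ?T (Suc i) q)))"
      by (rule ext, subst weak_val_dissect) (use f v pq in \<open>auto simp: sum.atLeast_Suc_atMost\<close>)
    also have "at_neg1 \<dots> = at_neg1 (\<lambda>k. f ({v p} + (*\<^sub>R) (real k) ` ?T p q))
        + (\<Sum>i\<in>{Suc p..q}. at_neg1 (\<lambda>k. f (?T p i + (*\<^sub>R) (real k) ` ?T i q)))
        - (\<Sum>i\<in>{p..<q}. at_neg1 (\<lambda>k. f (?T p i + (*\<^sub>R) (real k) ` ?T (Suc i) q)))"
    proof -
      have 1: "poly_seq (m + CARD('n)) (\<lambda>k. f ({v p} + (*\<^sub>R) (real k) ` ?T p q))"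
        using poly[of p p] pq by simp
      have 2: "poly_seq (m + CARD('n)) (\<lambda>k. f (?T p i + (*\<^sub>R) (real k) ` ?T i q))" if "i \<in> {Suc p..q}" for i
        using that by (intro poly) auto
      have 3: "poly_seq (m + CARD('n)) (\<lambda>k. f (?T p i + (*\<^sub>R) (real k) ` ?T (Suc i) q))" if "i \<in> {p..<q}" for i
        using that by (intro poly) auto
      have "poly_seq (m + CARD('n)) (\<lambda>k. \<Sum>i\<in>{Suc p..q}. f (?T p i + (*\<^sub>R) (real k) ` ?T i q))"
        "poly_seq (m + CARD('n)) (\<lambda>k. \<Sum>i\<in>{p..<q}. f (?T p i + (*\<^sub>R) (real k) ` ?T (Suc i) q))"
        using 2 3 by (auto intro: poly_seq_sum)
      moreover have "at_neg1 (\<lambda>k. \<Sum>i\<in>{Suc p..q}. f (?T p i + (*\<^sub>R) (real k) ` ?T i q))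
          = (\<Sum>i\<in>{Suc p..q}. at_neg1 (\<lambda>k. f (?T p i + (*\<^sub>R) (real k) ` ?T i q)))"
        using 2 by (rule at_neg1_sum)
      moreover have "at_neg1 (\<lambda>k. \<Sum>i\<in>{p..<q}. f (?T p i + (*\<^sub>R) (real k) ` ?T (Suc i) q))
          = (\<Sum>i\<in>{p..<q}. at_neg1 (\<lambda>k. f (?T p i + (*\<^sub>R) (real k) ` ?T (Suc i) q)))"
        using 3 by (rule at_neg1_sum)
      ultimately show ?thesis
        by (subst at_neg1_diff) (auto intro: poly_seq_add 1 simp: at_neg1_add[OF 1])
    qed
    also have "(\<Sum>i\<in>{Suc p..q}. at_neg1 (\<lambda>k. f (?T p i + (*\<^sub>R) (real k) ` ?T i q))) = (\<Sum>i\<in>{Suc p..q}. c i {i..q})"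
      by (intro sum.cong IH) auto
    also have "(\<Sum>i\<in>{p..<q}. at_neg1 (\<lambda>k. f (?T p i + (*\<^sub>R) (real k) ` ?T (Suc i) q))) = (\<Sum>i\<in>{p..q}. c i {Suc i..q})"
    proof -
      have "(\<Sum>i\<in>{p..<q}. at_neg1 (\<lambda>k. f (?T p i + (*\<^sub>R) (real k) ` ?T (Suc i) q))) = (\<Sum>i\<in>{p..<q}. c i {Suc i..q})"
        by (intro sum.cong IH) auto
      \<comment> \<open>The added index \<open>q\<close> contributes a sum over the nonempty subsets
        of the empty set.\<close>
      also have "\<dots> = (\<Sum>i\<in>{p..q}. c i {Suc i..q})"
        using pq by (intro sum.mono_neutral_left) (auto simp: c_def)
      finally show ?thesis .
    qed
    \<comment> \<open>The term for i = p is added and subtracted, so that the sum runs over all of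
      \<open>{p..q}\<close> as \<open>sum_difference_body\<close> requires.\<close>
    finally have total: "f {0} = at_neg1 (\<lambda>k. f ({v p} + (*\<^sub>R) (real k) ` ?T p q))
        + (\<Sum>i\<in>{p..q}. c i {i..q} - c i {Suc i..q}) - c p {p..q}"
      using pq by (simp add: sum_subtractf sum.atLeast_Suc_atMost[of p q "\<lambda>i. c i {i..q}"])
    have "c i {i..q} - c i {Suc i..q} = (\<Sum>S\<in>Pow {Suc i..q}. (-1) ^ card S * g i (insert i S))"
      if "i \<in> {p..q}" for i
    proof -
      have "{i..q} = insert i {Suc i..q}" using that by auto
      moreover have "card (insert i S) = Suc (card S)" if "S \<in> Pow {Suc i..q}" for S
        using that finite_subset[of S "{Suc i..q}"] by (subst card_insert_disjoint) auto
      ultimately show ?thesis unfolding c_def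
        by (simp add: sum_diff1 sum_Pow_insert Pow_bottom del: Pow_iff cong: sum.cong)
    qed
    then have "(\<Sum>i\<in>{p..q}. c i {i..q} - c i {Suc i..q})
        = (\<Sum>i\<in>{p..q}. \<Sum>S\<in>Pow {Suc i..q}. (-1) ^ card S * g i (insert i S))"
      by (rule sum.cong[OF refl])
    also have "\<dots> = f {0}"
      unfolding g_def by (rule sum_difference_body[OF f(1) v pq])
    finally have "at_neg1 (\<lambda>k. f ({v p} + (*\<^sub>R) (real k) ` ?T p q)) = c p {p..q}"
      using total by simp
    then show ?thesis by (simp add: c_def g_def)
  qed
  have vp: "v p \<in> int_lattice" using v[of p] pq by simp
  \<comment> \<open>Precomposing \<open>f\<close> with the translation by \<open>- v p\<close>
    removes the translation from the result just obtained.\<close>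
  have cancel: "{- v p} + ({v p} + X) = X" for X
    by (auto simp: set_plus_def)
  have "weak_val (\<lambda>P. f ({- v p} + P))" "transl_poly m (\<lambda>P. f ({- v p} + P))"
    using less.prems(1,2) vp by (auto intro!: weak_val_plus transl_poly_plus lpolys_singleton int_lattice_uminus)
  from shifted[OF this] show ?case by (simp only: cancel)
qed

subsection \<open>Faces in a given direction\<close>

definition top_face :: "(real ^ 'n::finite) set \<Rightarrow> real ^ 'n \<Rightarrow> (real ^ 'n) set" where
  "top_face P u = {x \<in> P. \<forall>y\<in>P. y \<bullet> u \<le> x \<bullet> u}"

definition face_sum :: "((real ^ 'n::finite) set \<Rightarrow> real) \<Rightarrow> (real ^ 'n) set \<Rightarrow> real" where
  "face_sum f P = (\<Sum>F | F face_of P \<and> F \<noteq> {}. (-1) ^ nat (aff_dim F) * f F)"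

lemma top_face_nonempty: "compact P \<Longrightarrow> P \<noteq> {} \<Longrightarrow> top_face P u \<noteq> {}"
  using continuous_attains_sup[of P "\<lambda>x. x \<bullet> u"] by (force simp: top_face_def intro: continuous_intros)

lemma top_face_eq_Int:
  assumes "p \<in> top_face P u"
  shows "top_face P u = P \<inter> {x. u \<bullet> x = u \<bullet> p}"
  using assms by (force simp: top_face_def inner_commute)

lemma top_face_face_of:
  assumes "convex P"
  shows "top_face P u face_of P"
proof (cases "top_face P u = {}")
  case False
  then obtain p where p: "p \<in> top_face P u" by blast
  then have "\<And>x. x \<in> P \<Longrightarrow> u \<bullet> x \<le> u \<bullet> p" by (simp add: top_face_def inner_commute)
  then show ?thesis unfolding top_face_eq_Int[OF p]
    by (rule face_of_Int_supporting_hyperplane_le[OF assms])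
qed simp

lemma lpolys_top_face: "P \<in> lpolys \<Longrightarrow> top_face P u \<in> lpolys"
  by (rule lpolys_face[OF _ top_face_face_of top_face_nonempty]) (auto simp: lpolys_convex lpolys_compact lpolys_nonempty)

text \<open>The point is that the lower top face lies in \<open>P\<close>: from any x in it, the
  segment towards p rises above the maximum over \<open>Q\<close> at once, hence runs in
  \<open>P\<close>, and \<open>P\<close> is closed.\<close>

lemma top_face_Un_Int_less:
  assumes "convex (P \<union> Q)" "closed P" and p: "p \<in> top_face P u" and q: "q \<in> top_face Q u" and less: "q \<bullet> u < p \<bullet> u"
  shows "top_face (P \<union> Q) u = top_face P u" "top_face (P \<inter> Q) u = top_face Q u"
proof -
  have pP: "p \<in> P" "\<And>y. y \<in> P \<Longrightarrow> y \<bullet> u \<le> p \<bullet> u" and qQ: "q \<in> Q" "\<And>y. y \<in> Q \<Longrightarrow> y \<bullet> u \<le> q \<bullet> u"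
    using p q by (auto simp: top_face_def)
  show "top_face (P \<union> Q) u = top_face P u"
  proof (intro equalityI subsetI)
    fix x assume "x \<in> top_face (P \<union> Q) u"
    then have x: "x \<in> P \<union> Q" "\<forall>y\<in>P \<union> Q. y \<bullet> u \<le> x \<bullet> u" by (auto simp: top_face_def)
    then have "p \<bullet> u \<le> x \<bullet> u" using pP(1) by simp
    then have "x \<notin> Q" using qQ(2)[of x] less by linarith
    then show "x \<in> top_face P u" using x by (simp add: top_face_def)
  next
    fix x assume "x \<in> top_face P u"
    then have x: "x \<in> P" "\<forall>y\<in>P. y \<bullet> u \<le> x \<bullet> u" by (auto simp: top_face_def)
    then have "p \<bullet> u \<le> x \<bullet> u" using pP(1) by simp
    then have "y \<bullet> u \<le> x \<bullet> u" if "y \<in> Q" for y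
      using qQ(2)[OF that] less by linarith
    then show "x \<in> top_face (P \<union> Q) u" using x by (auto simp: top_face_def)
  qed
  have "x \<in> P" if x: "x \<in> top_face Q u" for x
  proof -
    have xq: "x \<in> Q" "x \<bullet> u = q \<bullet> u" using x q by (auto simp: top_face_def intro: antisym)
    have "(1 - s) *\<^sub>R x + s *\<^sub>R p \<in> P" if s: "0 < s" "s \<le> 1" for s
    proof -
      have "(1 - s) *\<^sub>R x + s *\<^sub>R p \<in> P \<union> Q"
        using assms(1) xq(1) pP(1) s by (intro convexD) auto
      moreover have "((1 - s) *\<^sub>R x + s *\<^sub>R p) \<bullet> u = q \<bullet> u + s * (p \<bullet> u - q \<bullet> u)"
        by (simp add: inner_add_left xq(2) algebra_simps)
      then have "((1 - s) *\<^sub>R x + s *\<^sub>R p) \<bullet> u > q \<bullet> u" using s less by simp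
      then have "(1 - s) *\<^sub>R x + s *\<^sub>R p \<notin> Q" using qQ(2) leD by blast
      ultimately show ?thesis by blast
    qed
    then have ev: "\<forall>\<^sub>F s in at_right 0. (1 - s) *\<^sub>R x + s *\<^sub>R p \<in> P"
      unfolding eventually_at_right_field by (intro exI[of _ 1]) auto
    have lim: "((\<lambda>s. (1 - s) *\<^sub>R x + s *\<^sub>R p) \<longlongrightarrow> (1 - 0) *\<^sub>R x + 0 *\<^sub>R p) (at_right 0)"
      by (intro tendsto_intros)
    show "x \<in> P"
      using Lim_in_closed_set[OF assms(2) ev _ lim] by simp
  qed
  then have sub: "top_face Q u \<subseteq> P" by blast
  then have "q \<in> P" using q by blast
  show "top_face (P \<inter> Q) u = top_face Q u"
  proof (intro equalityI subsetI)
    fix x assume "x \<in> top_face (P \<inter> Q) u"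
    then have "x \<in> Q" "q \<bullet> u \<le> x \<bullet> u" using \<open>q \<in> P\<close> qQ(1) by (auto simp: top_face_def)
    then show "x \<in> top_face Q u" by (auto simp: top_face_def intro: order_trans[OF qQ(2)])
  next
    fix x assume "x \<in> top_face Q u"
    then show "x \<in> top_face (P \<inter> Q) u" using sub by (auto simp: top_face_def)
  qed
qed

text \<open>A segment joining maximisers of the two sets stays at the common maximal height and
  meets the intersection by connectedness, so the intersection attains the same maximum.\<close>

lemma top_face_Un_Int_eq:
  assumes "convex (P \<union> Q)" "closed P" "closed Q" and p: "p \<in> top_face P u" and q: "q \<in> top_face Q u" and eq: "q \<bullet> u = p \<bullet> u"
  shows "top_face (P \<union> Q) u = top_face P u \<union> top_face Q u" "top_face (P \<inter> Q) u = top_face P u \<inter> top_face Q u"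
proof -
  have pP: "p \<in> P" "\<And>y. y \<in> P \<Longrightarrow> y \<bullet> u \<le> p \<bullet> u" and qQ: "q \<in> Q" "\<And>y. y \<in> Q \<Longrightarrow> y \<bullet> u \<le> q \<bullet> u"
    using p q by (auto simp: top_face_def)
  have top: "top_face P u = {x \<in> P. x \<bullet> u = p \<bullet> u}" "top_face Q u = {x \<in> Q. x \<bullet> u = p \<bullet> u}"
    using top_face_eq_Int[OF p] top_face_eq_Int[OF q] eq by (auto simp: inner_commute)
  have "p \<in> top_face (P \<union> Q) u" using pP qQ eq by (auto simp: top_face_def)
  from top_face_eq_Int[OF this] show "top_face (P \<union> Q) u = top_face P u \<union> top_face Q u"
    unfolding top by (auto simp: inner_commute)
  have "closed_segment p q \<subseteq> P \<union> Q" using assms(1) pP(1) qQ(1) by (simp add: closed_segment_subset)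
  moreover have "connected (closed_segment p q)" by simp
  ultimately have "P \<inter> Q \<inter> closed_segment p q \<noteq> {}"
    using assms(2,3) pP qQ connected_closedD by (metis IntI ends_in_segment empty_iff)
  then obtain w where w: "w \<in> P" "w \<in> Q" "w \<in> closed_segment p q" by auto
  then obtain t where "w = (1 - t) *\<^sub>R p + t *\<^sub>R q" by (auto simp: in_segment)
  then have "w \<bullet> u = (1 - t) * (p \<bullet> u) + t * (p \<bullet> u)" by (simp add: inner_add_left eq)
  then have wu: "w \<bullet> u = p \<bullet> u" by (simp add: algebra_simps)
  then have "w \<in> top_face (P \<inter> Q) u" using w pP by (auto simp: top_face_def)
  from top_face_eq_Int[OF this] show "top_face (P \<inter> Q) u = top_face P u \<inter> top_face Q u"
    unfolding top using wu by (auto simp: inner_commute)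
qed

lemma weak_val_top_face:
  assumes "weak_val f"
  shows "weak_val (\<lambda>P. f (top_face P u))"
proof (rule weak_valI)
  fix P Q :: "(real ^ 'a) set"
  assume PQ: "P \<in> lpolys" "Q \<in> lpolys" "P \<union> Q \<in> lpolys" "P \<inter> Q \<in> lpolys"
  have closed: "closed P" "closed Q" and conv: "convex (P \<union> Q)" "convex (Q \<union> P)"
    using PQ by (auto simp: lpolys_compact compact_imp_closed lpolys_convex Un_commute)
  obtain p where p: "p \<in> top_face P u" using PQ top_face_nonempty lpolys_compact lpolys_nonempty by blast
  obtain q where q: "q \<in> top_face Q u" using PQ top_face_nonempty lpolys_compact lpolys_nonempty by blast
  consider "q \<bullet> u < p \<bullet> u" | "p \<bullet> u < q \<bullet> u" | "q \<bullet> u = p \<bullet> u" by linarith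
  then show "f (top_face P u) + f (top_face Q u) = f (top_face (P \<union> Q) u) + f (top_face (P \<inter> Q) u)"
  proof cases
    case 1
    then show ?thesis using top_face_Un_Int_less[OF conv(1) closed(1) p q] by simp
  next
    case 2
    then show ?thesis using top_face_Un_Int_less[OF conv(2) closed(2) q p] by (simp add: Un_commute Int_commute)
  next
    case 3
    then show ?thesis
      using top_face_Un_Int_eq[OF conv(1) closed p q] PQ[THEN lpolys_top_face[where u = u]]
      by (simp add: weak_valD[OF assms])
  qed
qed

subsection \<open>Cells of hyperplane arrangements\<close>

text \<open>Relatively open convex sets in a form that is visibly closed under intersection. Cells
  of hyperplane arrangements and the cones of directions selecting a face are both of this
  kind.\<close>

definition open_flat :: "'a::euclidean_space set \<Rightarrow> bool" where
  "open_flat C \<longleftrightarrow> (\<exists>M T. affine M \<and> open T \<and> convex T \<and> C = M \<inter> T)"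

text \<open>The Euler characteristic with compact support of a relatively open convex set, which is
  additive when the set is cut by a hyperplane.\<close>

definition euler :: "'a::euclidean_space set \<Rightarrow> real" where
  "euler C = (if C = {} then 0 else (-1) ^ nat (aff_dim C))"

lemma open_flat_UNIV: "open_flat UNIV"
  unfolding open_flat_def using affine_UNIV by (intro exI[of _ UNIV]) auto

lemma open_flat_Int: 
  assumes "open_flat C" "open_flat D"
  shows "open_flat (C \<inter> D)"
proof -
  obtain M T M' T' where "affine M" "open T" "convex T" "C = M \<inter> T" "affine M'" "open T'" "convex T'" "D = M' \<inter> T'"
    using assms unfolding open_flat_def by blast
  then show ?thesis unfolding open_flat_def
    by (intro exI[of _ "M \<inter> M'"] exI[of _ "T \<inter> T'"]) (auto simp: affine_Int convex_Int open_Int)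
qed

lemma open_flat_hyperplane: "open_flat {u. a \<bullet> u = 0}"
  unfolding open_flat_def by (intro exI[of _ "{u. a \<bullet> u = 0}"] exI[of _ UNIV]) (auto simp: affine_hyperplane)

lemma open_flat_halfspace: "open_flat {u. a \<bullet> u < 0}" "open_flat {u. a \<bullet> u > 0}"
  unfolding open_flat_def
  using affine_UNIV open_halfspace_lt[of a 0] open_halfspace_gt[of 0 a] convex_halfspace_lt[of a 0]
    convex_halfspace_gt[of 0 a]
  by (metis Int_UNIV_left)+

lemma aff_dim_open_flat:
  "affine M \<Longrightarrow> open T \<Longrightarrow> M \<inter> T \<noteq> {} \<Longrightarrow> aff_dim (M \<inter> T) = aff_dim M"
  by (simp add: affine_imp_convex aff_dim_convex_Int_open)

text \<open>Relative openness allows a segment to be prolonged a little past its end point. This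
  supplies points on both sides of a hyperplane through \<open>z\<close>.\<close>

lemma open_flat_opposite:
  assumes "open_flat C" "z \<in> C" "y \<in> C"
  obtains e where "e > 0" "z + e *\<^sub>R (z - y) \<in> C"
proof -
  obtain M T where C: "affine M" "open T" "C = M \<inter> T" using assms(1) unfolding open_flat_def by blast
  have "((\<lambda>e. z + e *\<^sub>R (z - y)) \<longlongrightarrow> z + 0 *\<^sub>R (z - y)) (at_right 0)"
    by (intro tendsto_intros)
  then have "\<forall>\<^sub>F e in at_right 0. z + e *\<^sub>R (z - y) \<in> T"
    using C assms(2) by (intro topological_tendstoD) auto
  then obtain b :: real where b: "b > 0" "\<forall>e>0. e < b \<longrightarrow> z + e *\<^sub>R (z - y) \<in> T"
    unfolding eventually_at_right_field by blast
  have "(1 + b / 2) *\<^sub>R z + (- (b / 2)) *\<^sub>R y \<in> M"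
    using C assms(2,3) by (intro mem_affine) auto
  then have "z + (b / 2) *\<^sub>R (z - y) \<in> M" by (simp add: algebra_simps)
  moreover have "z + (b / 2) *\<^sub>R (z - y) \<in> T" using b by auto
  ultimately show thesis using that[of "b / 2"] b C(3) by simp
qed

text \<open>When the hyperplane properly cuts \<open>C\<close>, both open halves keep the dimension
  d and the section has dimension d - 1, so two of the three signs cancel. Otherwise at most one
  piece is nonempty, and it is \<open>C\<close>.\<close>

lemma euler_split:
  assumes "open_flat C"
  shows "euler C = euler (C \<inter> {u. a \<bullet> u < 0}) + euler (C \<inter> {u. a \<bullet> u = 0}) + euler (C \<inter> {u. a \<bullet> u > 0})"
proof -
  let ?N = "{u. a \<bullet> u < 0}" and ?H = "{u. a \<bullet> u = 0}" and ?P = "{u. a \<bullet> u > 0}"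
  obtain M T where M: "affine M" "open T" "convex T" "C = M \<inter> T" using assms unfolding open_flat_def by blast
  have conn: "connected C" using M by (simp add: affine_imp_convex convex_Int convex_connected)
  show ?thesis
  proof (cases "C \<inter> ?H = {}")
    case True
    have "C \<inter> ?N = {} \<or> C \<inter> ?P = {}"
    proof (rule ccontr)
      assume "\<not> (C \<inter> ?N = {} \<or> C \<inter> ?P = {})"
      then obtain x y where "x \<in> C" "a \<bullet> x < 0" "y \<in> C" "a \<bullet> y > 0" by blast
      then obtain z where "z \<in> C" "a \<bullet> z = 0"
        using connected_ivt_hyperplane[OF conn, of x y a 0] by auto
      then show False using True by blast
    qed
    moreover have "C = C \<inter> ?N \<union> C \<inter> ?P" using True by fastforce
    ultimately have "C \<inter> ?N = {} \<and> C \<inter> ?P = C \<or> C \<inter> ?P = {} \<and> C \<inter> ?N = C" by blast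
    then show ?thesis using True by (auto simp: euler_def)
  next
    case False
    then obtain z where z: "z \<in> C" "a \<bullet> z = 0" by blast
    show ?thesis
    proof (cases "C \<subseteq> ?H")
      case True
      then have "C \<inter> ?N = {}" "C \<inter> ?P = {}" "C \<inter> ?H = C" by force+
      then show ?thesis by (simp add: euler_def)
    next
      case False
      then obtain y where y: "y \<in> C" "a \<bullet> y \<noteq> 0" by blast
      obtain e where e: "e > 0" "z + e *\<^sub>R (z - y) \<in> C"
        using open_flat_opposite[OF assms z(1) y(1)] by blast
      define y' where "y' = z + e *\<^sub>R (z - y)"
      have "a \<bullet> y' = - e * (a \<bullet> y)" by (simp add: y'_def inner_add_right inner_diff_right z)
      then have "a \<bullet> y < 0 \<and> a \<bullet> y' > 0 \<or> a \<bullet> y > 0 \<and> a \<bullet> y' < 0"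
        using e(1) y(2) by (auto simp: zero_less_mult_iff mult_less_0_iff)
      then have ne: "C \<inter> ?N \<noteq> {}" "C \<inter> ?P \<noteq> {}" "C \<inter> ?H \<noteq> {}" "C \<noteq> {}"
        using y(1) e(2) z y'_def by blast+
      have dim: "aff_dim C = aff_dim M" using aff_dim_open_flat M ne(4) by metis
      have "C \<inter> ?N = M \<inter> (T \<inter> ?N)" "C \<inter> ?P = M \<inter> (T \<inter> ?P)" "C \<inter> ?H = (M \<inter> ?H) \<inter> T" using M(4) by auto
      then have dims: "aff_dim (C \<inter> ?N) = aff_dim M" "aff_dim (C \<inter> ?P) = aff_dim M" "aff_dim (C \<inter> ?H) = aff_dim (M \<inter> ?H)"
        using ne M open_halfspace_lt[of a 0] open_halfspace_gt[of 0 a] affine_hyperplane[of a 0]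
        by (simp_all add: aff_dim_open_flat open_Int affine_Int)
      have "aff_dim (M \<inter> ?H) = aff_dim M - 1"
        using aff_dim_affine_Int_hyperplane[OF M(1), of a 0] M(4) z y by auto
      moreover have "aff_dim (M \<inter> ?H) \<noteq> -1" "aff_dim (M \<inter> ?H) \<ge> -1"
        using z M(4) by (auto simp: aff_dim_empty[symmetric] aff_dim_geq)
      ultimately have "nat (aff_dim M) = Suc (nat (aff_dim (M \<inter> ?H)))" by linarith
      then show ?thesis using ne dims dim by (simp add: euler_def)
    qed
  qed
qed

text \<open>The sum of \<open>euler D * \<phi> D\<close> over the cells \<open>D\<close> into which the hyperplanes orthogonal to the
  members of the list cut \<open>C\<close>, for \<open>\<phi>\<close> constant on cells.\<close>

fun cell_sum :: "'a::euclidean_space list \<Rightarrow> 'a set \<Rightarrow> ('a \<Rightarrow> real) \<Rightarrow> real" where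
  "cell_sum [] C \<phi> = euler C * \<phi> (SOME u. u \<in> C)"
| "cell_sum (a # K) C \<phi> = cell_sum K (C \<inter> {u. a \<bullet> u < 0}) \<phi>
    + cell_sum K (C \<inter> {u. a \<bullet> u = 0}) \<phi> + cell_sum K (C \<inter> {u. a \<bullet> u > 0}) \<phi>"

lemma cell_sum_add: "cell_sum K C (\<lambda>u. \<phi> u + \<psi> u) = cell_sum K C \<phi> + cell_sum K C \<psi>"
  by (induction K arbitrary: C) (simp_all add: algebra_simps)

lemma cell_sum_cmult: "cell_sum K C (\<lambda>u. c * \<phi> u) = c * cell_sum K C \<phi>"
  by (induction K arbitrary: C) (simp_all add: algebra_simps)

lemma cell_sum_zero: "cell_sum K C (\<lambda>u. 0) = 0"
  by (induction K arbitrary: C) simp_all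

lemma cell_sum_sum: "cell_sum K C (\<lambda>u. \<Sum>i\<in>I. \<phi> i u) = (\<Sum>i\<in>I. cell_sum K C (\<phi> i))"
  by (induction I rule: infinite_finite_induct) (simp_all add: cell_sum_add cell_sum_zero)

text \<open>The sign condition says that \<open>N\<close> is a union of cells within
  \<open>C\<close>, so the arbitrary representative of a cell decides for the whole cell. The rest
  is additivity of \<open>euler\<close> on \<open>C \<inter> N\<close>.\<close>

lemma cell_sum_indicator:
  assumes "open_flat C" "open_flat N"
    and "\<And>u u'. u \<in> C \<Longrightarrow> u' \<in> C \<Longrightarrow> (\<And>a. a \<in> set K \<Longrightarrow> sgn (a \<bullet> u) = sgn (a \<bullet> u')) \<Longrightarrow> u \<in> N \<Longrightarrow> u' \<in> N"
  shows "cell_sum K C (indicator N) = euler (C \<inter> N)"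
  using assms
proof (induction K arbitrary: C)
  case Nil
  show ?case
  proof (cases "C = {}")
    case False
    then have some: "(SOME u. u \<in> C) \<in> C" by (simp add: some_in_eq)
    show ?thesis
    proof (cases "(SOME u. u \<in> C) \<in> N")
      case True
      then have "C \<inter> N = C" using Nil.prems(3) some by auto
      then show ?thesis using True by simp
    next
      case False
      then have "C \<inter> N = {}" using Nil.prems(3) some by auto
      then show ?thesis using False by (simp add: euler_def)
    qed
  qed (simp add: euler_def)
next
  case (Cons a K)
  let ?X = "{{u. a \<bullet> u < 0}, {u. a \<bullet> u = 0}, {u. a \<bullet> u > 0}}"
  have IH: "cell_sum K (C \<inter> H) (indicator N) = euler (C \<inter> N \<inter> H)" if "H \<in> ?X" for H
  proof -
    have "cell_sum K (C \<inter> H) (indicator N) = euler (C \<inter> H \<inter> N)"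
    proof (rule Cons.IH)
      show "open_flat (C \<inter> H)"
        using that Cons.prems(1) by (auto intro: open_flat_Int open_flat_hyperplane open_flat_halfspace)
      show "u' \<in> N" if "u \<in> C \<inter> H" "u' \<in> C \<inter> H" "\<And>a. a \<in> set K \<Longrightarrow> sgn (a \<bullet> u) = sgn (a \<bullet> u')" "u \<in> N" for u u'
      proof (rule Cons.prems(3)[of u u'])
        fix b assume "b \<in> set (a # K)"
        moreover have "sgn (a \<bullet> u) = sgn (a \<bullet> u')"
          using that(1,2) \<open>H \<in> ?X\<close> by (auto simp: sgn_if)
        ultimately show "sgn (b \<bullet> u) = sgn (b \<bullet> u')"
          using that(3) by auto
      qed (use that in auto)
    qed (rule Cons.prems(2))
    also have "C \<inter> H \<inter> N = C \<inter> N \<inter> H" by blast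
    finally show ?thesis .
  qed
  show ?case
    using euler_split[OF open_flat_Int[OF Cons.prems(1,2)], of a] by (simp add: IH)
qed

subsection \<open>The alternating face sum is a valuation\<close>

text \<open>The directions in which \<open>F\<close> is the top face form a relatively open cone of dimension
  \<open>n - dim F\<close>. Hence \<open>face_sum f P\<close> is, up to sign, the integral of \<open>f (top_face P u)\<close> over all
  directions \<open>u\<close> with respect to the Euler characteristic, and for fixed \<open>u\<close> the integrand is a
  valuation in \<open>P\<close>.\<close>

lemma hull_face_vertices:
  fixes A :: "(real ^ 'n::finite) set"
  assumes "finite A" "F face_of (convex hull A)"
  shows "F = convex hull (A \<inter> F)"
proof
  obtain B where B: "B \<subseteq> A" "F = convex hull B"
    using face_of_convex_hull_subset[OF finite_imp_compact[OF assms(1)] assms(2)] by blast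
  then have "B \<subseteq> A \<inter> F" using hull_subset by fastforce
  then show "F \<subseteq> convex hull (A \<inter> F)" unfolding B(2) by (rule hull_mono)
  show "convex hull (A \<inter> F) \<subseteq> F" by (simp add: B(2) hull_minimal)
qed

lemma Int_top_face_hull:
  fixes A :: "(real ^ 'n::finite) set"
  shows "A \<inter> top_face (convex hull A) u = {a \<in> A. \<forall>b\<in>A. b \<bullet> u \<le> a \<bullet> u}"
proof -
  have "\<forall>y\<in>convex hull A. y \<bullet> u \<le> a \<bullet> u" if "\<forall>b\<in>A. b \<bullet> u \<le> a \<bullet> u" for a
  proof -
    have "convex hull A \<subseteq> {y. u \<bullet> y \<le> u \<bullet> a}"
      using that by (intro hull_minimal convex_halfspace_le) (auto simp: inner_commute)
    then show ?thesis by (auto simp: inner_commute)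
  qed
  then show ?thesis by (auto simp: top_face_def hull_inc)
qed

text \<open>Only signs of (a - b) \<bullet> u occur on the right. This exhibits the cone of
  directions selecting \<open>F\<close> as a subspace cut by open half-spaces and shows that it is a
  union of cells of the arrangement orthogonal to the differences.\<close>

lemma top_face_hull_eq_iff:
  fixes A :: "(real ^ 'n::finite) set"
  assumes "finite A" "F face_of (convex hull A)" "F \<noteq> {}"
  shows "top_face (convex hull A) u = F \<longleftrightarrow>
    (\<forall>a\<in>A \<inter> F. \<forall>b\<in>A \<inter> F. (a - b) \<bullet> u = 0) \<and> (\<forall>b\<in>A \<inter> F. \<forall>c\<in>A - F. (c - b) \<bullet> u < 0)"
proof -
  let ?M = "{a \<in> A. \<forall>b\<in>A. b \<bullet> u \<le> a \<bullet> u}"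
  have "top_face (convex hull A) u = convex hull ?M"
    using hull_face_vertices[OF assms(1) top_face_face_of[of "convex hull A" u]] by (simp add: Int_top_face_hull)
  moreover have "F = convex hull (A \<inter> F)" by (rule hull_face_vertices[OF assms(1,2)])
  ultimately have "top_face (convex hull A) u = F \<longleftrightarrow> ?M = A \<inter> F"
    using Int_top_face_hull[of A u] by metis
  also have "\<dots> \<longleftrightarrow> (\<forall>a\<in>A \<inter> F. \<forall>b\<in>A \<inter> F. (a - b) \<bullet> u = 0) \<and> (\<forall>b\<in>A \<inter> F. \<forall>c\<in>A - F. (c - b) \<bullet> u < 0)"
    (is "_ \<longleftrightarrow> ?R")
  proof
    assume M: "?M = A \<inter> F"
    have "(a - b) \<bullet> u = 0" if "a \<in> ?M" "b \<in> ?M" for a b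
      using that by (simp add: inner_diff_left antisym)
    moreover have "(c - b) \<bullet> u < 0" if bc: "b \<in> ?M" "c \<in> A" "c \<notin> ?M" for b c
    proof -
      obtain d where "d \<in> A" "c \<bullet> u < d \<bullet> u" using bc(2,3) by force
      then show ?thesis using bc(1) by (force simp: inner_diff_left)
    qed
    ultimately show ?R unfolding M by blast
  next
    assume R: ?R
    obtain b0 where b0: "b0 \<in> A \<inter> F" using \<open>F = convex hull (A \<inter> F)\<close> assms(3) by (metis convex_hull_empty ex_in_conv)
    show "?M = A \<inter> F"
    proof (intro equalityI subsetI)
      fix a assume a: "a \<in> ?M"
      then have "b0 \<bullet> u \<le> a \<bullet> u" using b0 by blast
      moreover have "(a - b0) \<bullet> u < 0" if "a \<notin> F" using R b0 a that by blast
      ultimately show "a \<in> A \<inter> F" using a by (fastforce simp: inner_diff_left)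
    next
      fix a assume a: "a \<in> A \<inter> F"
      then have "(b - a) \<bullet> u \<le> 0" if "b \<in> A" for b
        using R that by (cases "b \<in> F") (auto intro: less_imp_le)
      then have "b \<bullet> u \<le> a \<bullet> u" if "b \<in> A" for b
        using that by (simp add: inner_diff_left)
      then show "a \<in> ?M" using a by blast
    qed
  qed
  finally show ?thesis .
qed

text \<open>The equations define the orthogonal complement of the direction space of
  \<open>F\<close>; the strict inequalities are open and do not lower its dimension once the cone is
  nonempty. It is nonempty because every face of a polytope is exposed, the exposing functional
  being a direction in the cone.\<close>

lemma normal_cone_euler:
  fixes A :: "(real ^ 'n::finite) set"
  assumes A: "finite A" and F: "F face_of (convex hull A)" "F \<noteq> {}"
  defines "N \<equiv> {u. top_face (convex hull A) u = F}"
  shows "open_flat N" "(-1) ^ nat (aff_dim F) = (-1) ^ CARD('n) * euler N"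
proof -
  let ?B = "A \<inter> F"
  define M where "M = {u. \<forall>a\<in>?B. \<forall>b\<in>?B. (a - b) \<bullet> u = 0}"
  define T where "T = {u. \<forall>b\<in>?B. \<forall>c\<in>A - F. (c - b) \<bullet> u < 0}"
  have N: "N = M \<inter> T" unfolding N_def M_def T_def using top_face_hull_eq_iff[OF A F] by auto
  have sub: "subspace M" by (auto simp: M_def subspace_def inner_add_right)
  have T: "T = (\<Inter>b\<in>?B. \<Inter>c\<in>A - F. {u. (c - b) \<bullet> u < 0})" by (auto simp: T_def)
  have "open T" unfolding T using A by (intro open_INT ballI open_halfspace_lt) auto
  moreover have "convex T" unfolding T by (intro convex_INT convex_halfspace_lt)
  ultimately show flat: "open_flat N"
    unfolding open_flat_def N using sub subspace_imp_affine by blast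
  have FB: "F = convex hull ?B" by (rule hull_face_vertices[OF A F(1)])
  then obtain b0 where b0: "b0 \<in> ?B" using F(2) by (metis convex_hull_empty ex_in_conv)
  let ?D = "(\<lambda>x. x - b0) ` ?B"
  have "M = {u \<in> UNIV. \<forall>x\<in>span ?D. orthogonal x u}"
  proof (intro equalityI subsetI)
    fix u assume u: "u \<in> M"
    have "orthogonal u x" if "x \<in> span ?D" for x
      using that by (rule orthogonal_to_span)
        (use u b0 in \<open>auto simp: M_def orthogonal_def inner_commute\<close>)
    then show "u \<in> {u \<in> UNIV. \<forall>x\<in>span ?D. orthogonal x u}" by (simp add: orthogonal_commute)
  next
    fix u assume "u \<in> {u \<in> UNIV. \<forall>x\<in>span ?D. orthogonal x u}"
    then have "a \<bullet> u = b0 \<bullet> u" if "a \<in> ?B" for a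
      using that span_base[of "a - b0" ?D] by (force simp: orthogonal_def inner_diff_left)
    then show "u \<in> M" by (simp add: M_def inner_diff_left)
  qed
  then have "dim M + dim ?D = CARD('n)"
    using dim_subspace_orthogonal_to_vectors[of "span ?D" UNIV] by (simp add: dim_span)
  moreover have "aff_dim F = int (dim ?D)"
    using aff_dim_eq_dim_subtract[of b0 ?B] b0 by (subst FB) (simp add: aff_dim_convex_hull hull_inc)
  moreover have "N \<noteq> {}"
  proof -
    have "F exposed_face_of (convex hull A)"
      using F(1) A by (simp add: exposed_face_of_polyhedron polyhedron_convex_hull)
    then obtain a c where a: "convex hull A \<subseteq> {x. a \<bullet> x \<le> c}" "F = convex hull A \<inter> {x. a \<bullet> x = c}"
      unfolding exposed_face_of_def by blast
    obtain x where "x \<in> F" using F(2) by blast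
    then have "top_face (convex hull A) a = F"
      using a by (force simp: top_face_def inner_commute)
    then show ?thesis by (auto simp: N_def)
  qed
  moreover from this have "aff_dim N = int (dim M)"
    using \<open>open T\<close> sub unfolding N by (simp add: aff_dim_open_flat subspace_imp_affine aff_dim_subspace)
  ultimately have "nat (aff_dim F) + nat (aff_dim N) = CARD('n)" "N \<noteq> {}" by auto
  then show "(-1) ^ nat (aff_dim F) = (-1) ^ CARD('n) * euler N"
    by (simp add: euler_def power_add flip: \<open>nat (aff_dim F) + nat (aff_dim N) = CARD('n)\<close>)
qed

text \<open>The list may be any one containing all differences of generating points; this freedom
  allows several polytopes to share one arrangement.\<close>

lemma face_sum_eq_cell_sum:
  fixes A :: "(real ^ 'n::finite) set"
  assumes A: "finite A" "A \<noteq> {}" and K: "\<And>a b. a \<in> A \<Longrightarrow> b \<in> A \<Longrightarrow> a - b \<in> set K"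
  shows "face_sum f (convex hull A) = (-1) ^ CARD('n) * cell_sum K UNIV (\<lambda>u. f (top_face (convex hull A) u))"
proof -
  let ?P = "convex hull A"
  let ?Fs = "{F. F face_of ?P \<and> F \<noteq> {}}"
  define N where "N = (\<lambda>F. {u. top_face ?P u = F})"
  have fin: "finite ?Fs"
    by (rule finite_subset[OF _ finite_polytope_faces[of ?P]]) (use A in \<open>auto simp: polytope_def\<close>)
  have "cell_sum K UNIV (indicator (N F)) = euler (N F)" if "F \<in> ?Fs" for F
  proof -
    have "cell_sum K UNIV (indicator (N F)) = euler (UNIV \<inter> N F)"
    proof (rule cell_sum_indicator[OF open_flat_UNIV])
      show "open_flat (N F)" unfolding N_def using normal_cone_euler(1)[OF A(1)] that by blast
      fix u u' assume "\<And>a. a \<in> set K \<Longrightarrow> sgn (a \<bullet> u) = sgn (a \<bullet> u')" "u \<in> N F"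
      moreover from this have "((a - b) \<bullet> u = 0 \<longleftrightarrow> (a - b) \<bullet> u' = 0) \<and> ((a - b) \<bullet> u < 0 \<longleftrightarrow> (a - b) \<bullet> u' < 0)"
        if "a \<in> A" "b \<in> A" for a b
        using K[OF that] by (metis sgn_0_0 sgn_less)
      ultimately show "u' \<in> N F"
        using that top_face_hull_eq_iff[OF A(1), of F] unfolding N_def by simp
    qed
    then show ?thesis by simp
  qed
  then have "face_sum f ?P = (\<Sum>F\<in>?Fs. (-1) ^ CARD('n) * (f F * cell_sum K UNIV (indicator (N F))))"
    unfolding face_sum_def N_def
    by (intro sum.cong refl) (use normal_cone_euler(2)[OF A(1)] in simp)
  also have "\<dots> = (-1) ^ CARD('n) * cell_sum K UNIV (\<lambda>u. \<Sum>F\<in>?Fs. f F * indicator (N F) u)"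
    by (simp add: cell_sum_sum cell_sum_cmult sum_distrib_left)
  also have "(\<lambda>u. \<Sum>F\<in>?Fs. f F * indicator (N F) u) = (\<lambda>u. f (top_face ?P u))"
  proof
    fix u
    have "top_face ?P u \<in> ?Fs"
      using top_face_face_of[of ?P u] top_face_nonempty[of ?P u] A
      by (simp add: finite_imp_compact_convex_hull)
    then show "(\<Sum>F\<in>?Fs. f F * indicator (N F) u) = f (top_face ?P u)"
      using fin by (subst sum.remove[of _ "top_face ?P u"]) (auto simp: N_def indicator_def intro!: sum.neutral)
  qed
  finally show ?thesis .
qed

lemma weak_val_face_sum:
  fixes f :: "(real ^ 'n::finite) set \<Rightarrow> real"
  assumes "weak_val f"
  shows "weak_val (face_sum f)"
proof (rule weak_valI)
  fix P Q :: "(real ^ 'n) set"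
  assume PQ: "P \<in> lpolys" "Q \<in> lpolys" "P \<union> Q \<in> lpolys" "P \<inter> Q \<in> lpolys"
  obtain A where A: "finite A" "A \<noteq> {}" "P = convex hull A" using PQ(1) by (rule lpolysE) blast
  obtain B where B: "finite B" "B \<noteq> {}" "Q = convex hull B" using PQ(2) by (rule lpolysE) blast
  obtain C where C: "finite C" "C \<noteq> {}" "P \<union> Q = convex hull C" using PQ(3) by (rule lpolysE) blast
  obtain D where D: "finite D" "D \<noteq> {}" "P \<inter> Q = convex hull D" using PQ(4) by (rule lpolysE) blast
  \<comment> \<open>One arrangement is taken fine enough for all four polytopes, so that the four
    face sums become sums over the same cells and the valuation identity for top faces can be
    applied cell by cell.\<close>
  have "finite ((\<lambda>(a, b). a - b) ` ((A \<union> B \<union> C \<union> D) \<times> (A \<union> B \<union> C \<union> D)))"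
    using A B C D by simp
  then obtain K where K: "set K = (\<lambda>(a, b). a - b) ` ((A \<union> B \<union> C \<union> D) \<times> (A \<union> B \<union> C \<union> D))"
    using finite_list by blast
  define s where "s = (\<lambda>P. (-1) ^ CARD('n) * cell_sum K UNIV (\<lambda>u. f (top_face P u)))"
  have "face_sum f P = s P" "face_sum f Q = s Q" "face_sum f (P \<union> Q) = s (P \<union> Q)" "face_sum f (P \<inter> Q) = s (P \<inter> Q)"
    unfolding s_def using A B C D by (simp_all only:) (rule face_sum_eq_cell_sum; force simp: K)+
  moreover have "s P + s Q = s (P \<union> Q) + s (P \<inter> Q)"
    using weak_valD[OF weak_val_top_face[OF assms] PQ]
    by (simp add: s_def distrib_left[symmetric] cell_sum_add[symmetric])
  ultimately show "face_sum f P + face_sum f Q = face_sum f (P \<union> Q) + face_sum f (P \<inter> Q)" by simp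
qed

subsection \<open>Reciprocity for lattice polytopes\<close>

definition dual_val :: "((real ^ 'n::finite) set \<Rightarrow> real) \<Rightarrow> (real ^ 'n) set \<Rightarrow> real" where
  "dual_val f P = at_neg1 (\<lambda>k. f ((*\<^sub>R) (real k) ` uminus ` P))"

lemma poly_seq_dilate_uminus:
  fixes P :: "(real ^ 'n::finite) set"
  assumes "weak_val f" "transl_poly m f" "P \<in> lpolys"
  shows "poly_seq (m + CARD('n)) (\<lambda>k. f ((*\<^sub>R) (real k) ` uminus ` P))"
  using assms by (intro poly_seq_dilate lpolys_uminus)

lemma weak_val_uminus: "weak_val f \<Longrightarrow> weak_val (\<lambda>P. f (uminus ` P))"
  using weak_val_scale[of f "-1"] by simp

lemma weak_val_dual:
  assumes "weak_val f" "transl_poly m f"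
  shows "weak_val (dual_val f)"
proof (rule weak_valI)
  fix P Q :: "(real ^ 'a) set"
  assume PQ: "P \<in> lpolys" "Q \<in> lpolys" "P \<union> Q \<in> lpolys" "P \<inter> Q \<in> lpolys"
  have "weak_val (\<lambda>P. f ((*\<^sub>R) (real k) ` uminus ` P))" for k
    by (rule weak_val_uminus[OF weak_val_scale[OF assms(1)]]) simp
  then have "(\<lambda>k. f ((*\<^sub>R) (real k) ` uminus ` P) + f ((*\<^sub>R) (real k) ` uminus ` Q))
      = (\<lambda>k. f ((*\<^sub>R) (real k) ` uminus ` (P \<union> Q)) + f ((*\<^sub>R) (real k) ` uminus ` (P \<inter> Q)))"
    using weak_valD[OF _ PQ] by blast
  from arg_cong[OF this, of at_neg1] show "dual_val f P + dual_val f Q = dual_val f (P \<union> Q) + dual_val f (P \<inter> Q)"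
    using PQ[THEN poly_seq_dilate_uminus[OF assms]] by (simp add: dual_val_def at_neg1_add)
qed

lemma face_sum_simplex:
  fixes A :: "(real ^ 'n::finite) set"
  assumes "finite A" "\<not> affine_dependent A"
  shows "face_sum f (convex hull A) = (\<Sum>S\<in>Pow A - {{}}. (-1) ^ Suc (card S) * f (convex hull S))"
proof -
  have faces: "{F. F face_of (convex hull A) \<and> F \<noteq> {}} = (\<lambda>S. convex hull S) ` (Pow A - {{}})"
    using assms(2) by (auto simp: face_of_convex_hull_affine_independent)
  have indep: "\<not> affine_dependent S" if "S \<subseteq> A" for S
    using assms(2) that affine_dependent_subset by blast
  have "inj_on (\<lambda>S. convex hull S) (Pow A)"
  proof (rule inj_onI)
    fix S T assume "S \<in> Pow A" "T \<in> Pow A" "convex hull S = convex hull T"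
    then show "S = T"
      using extreme_point_of_convex_hull_affine_independent indep by (metis PowD subsetI subset_antisym)
  qed
  then have inj: "inj_on (\<lambda>S. convex hull S) (Pow A - {{}})" by (rule inj_on_subset) auto
  have sign: "(-1) ^ nat (aff_dim (convex hull S)) = ((-1) ^ Suc (card S) :: real)" if "S \<in> Pow A - {{}}" for S
  proof -
    have "finite S" "S \<noteq> {}" using that assms(1) finite_subset by auto
    then have "card S > 0" by (simp add: card_gt_0_iff)
    then have "Suc (card S) = nat (int (card S) - 1) + 2" by linarith
    then show ?thesis
      using that indep[of S] by (simp add: aff_dim_convex_hull aff_dim_affine_independent)
  qed
  show ?thesis
    unfolding face_sum_def faces sum.reindex[OF inj] by (intro sum.cong) (auto simp: sign simp del: power_Suc)
qed

lemma face_sum_eq_dual_val_simplex: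
  fixes A :: "(real ^ 'n::finite) set"
  assumes f: "weak_val f" "transl_poly m f"
    and A: "finite A" "A \<noteq> {}" "A \<subseteq> int_lattice" "\<not> affine_dependent A"
  shows "face_sum f (convex hull A) = dual_val f (convex hull A)"
proof -
  define q where "q = card A - 1"
  obtain v where "bij_betw v {0..<card A} A" using ex_bij_betw_nat_finite[OF A(1)] by blast
  moreover have "card A > 0" using A by (simp add: card_gt_0_iff)
  then have "{0..<card A} = {0..q}" by (auto simp: q_def)
  ultimately have v: "bij_betw v {0..q} A" by simp
  \<comment> \<open>The evaluation at -1 produces reflected hulls, so it is applied to the reflected
    vertices; this matches the reflection built into \<open>dual_val\<close>.\<close>
  define w where "w = (\<lambda>i. - v i)"
  have uminus_hull: "uminus ` (convex hull (v ` S)) = convex hull (w ` S)" "uminus ` (convex hull (w ` S)) = convex hull (v ` S)" for S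
    using convex_hull_scaling[of "-1" "v ` S"] convex_hull_scaling[of "-1" "w ` S"]
    by (simp_all add: w_def image_image)
  have w: "w i \<in> int_lattice" if "i \<in> {0..q}" for i
  proof -
    have "v i \<in> A" using that v bij_betwE by blast
    then show ?thesis using A(3) unfolding w_def by (intro int_lattice_uminus) blast
  qed
  have "dual_val f (convex hull A) = at_neg1 (\<lambda>k. f ((*\<^sub>R) (real k) ` (convex hull (w ` {0..q}))))"
    using v by (simp add: dual_val_def bij_betw_def flip: uminus_hull)
  also have "\<dots> = (\<Sum>S\<in>Pow {0..q} - {{}}. (-1) ^ Suc (card S) * f (convex hull (v ` S)))"
    using at_neg1_dilate_hull[OF f w] by (simp add: uminus_hull)
  also have "\<dots> = (\<Sum>S\<in>Pow A - {{}}. (-1) ^ Suc (card S) * f (convex hull S))"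
  proof -
    have "(\<Sum>S\<in>Pow A. (-1) ^ Suc (card S) * f (convex hull S))
        = (\<Sum>S\<in>Pow {0..q}. (-1) ^ Suc (card (v ` S)) * f (convex hull (v ` S)))"
      using sum.reindex_bij_betw[OF bij_betw_Pow[OF v], symmetric] .
    also have "\<dots> = (\<Sum>S\<in>Pow {0..q}. (-1) ^ Suc (card S) * f (convex hull (v ` S)))"
    proof (rule sum.cong[OF refl])
      fix S assume "S \<in> Pow {0..q}"
      then have "card (v ` S) = card S"
        using v by (intro card_image) (auto simp: bij_betw_def intro: inj_on_subset)
      then show "(-1) ^ Suc (card (v ` S)) * f (convex hull (v ` S)) = (-1) ^ Suc (card S) * f (convex hull (v ` S))"
        by simp
    qed
    finally show ?thesis using A(1) by (simp add: sum_diff1 Pow_bottom del: Pow_iff)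
  qed
  finally show ?thesis using face_sum_simplex[OF A(1,4)] by simp
qed

lemma face_sum_eq_dual_val:
  assumes f: "weak_val f" "transl_poly m f" and "P \<in> lpolys"
  shows "face_sum f P = dual_val f P"
proof -
  have "face_sum f P - dual_val f P = 0"
    using weak_val_diff[OF weak_val_face_sum weak_val_dual, OF f(1) f] assms(3)
    by (rule weak_val_zero_if_zero_on_simplices) (simp add: face_sum_eq_dual_val_simplex[OF f])
  then show ?thesis by simp
qed

lemma face_sum_linear_image:
  assumes "linear h" "inj h"
  shows "face_sum f (h ` P) = (\<Sum>F | F face_of P \<and> F \<noteq> {}. (-1) ^ nat (aff_dim F) * f (h ` F))"
proof -
  have "{F. F face_of h ` P \<and> F \<noteq> {}} = (`) h ` {F. F face_of P \<and> F \<noteq> {}}"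
  proof (intro equalityI subsetI)
    fix F assume F: "F \<in> {F. F face_of h ` P \<and> F \<noteq> {}}"
    then have "F \<subseteq> h ` P" by (simp add: face_of_imp_subset)
    then obtain G where "F = h ` G" by (metis subset_imageE)
    then show "F \<in> (`) h ` {F. F face_of P \<and> F \<noteq> {}}"
      using F face_of_linear_image[OF assms] by auto
  qed (use face_of_linear_image[OF assms] in auto)
  moreover have "inj_on ((`) h) X" for X
    using assms(2) by (auto simp: inj_on_def inj_image_eq_iff)
  ultimately show ?thesis
    unfolding face_sum_def by (simp add: sum.reindex aff_dim_injective_linear_image[OF assms])
qed

text \<open>The face sum of the dilate \<open>-k P\<close> is the value at \<open>-k\<close> of the polynomial \<open>f (k P)\<close>;
  as an identity of polynomials in \<open>k\<close> this can be read off at \<open>k = -1\<close>.\<close>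

lemma face_sum_dual_val:
  fixes P :: "(real ^ 'n::finite) set"
  assumes f: "weak_val f" "transl_poly m f" and P: "P \<in> lpolys"
  shows "(\<Sum>F | F face_of P \<and> F \<noteq> {}. (-1) ^ nat (aff_dim F) * dual_val f F) = f P"
proof -
  let ?Fs = "{F. F face_of P \<and> F \<noteq> {}}"
  define G where "G = (\<lambda>k. \<Sum>F\<in>?Fs. (-1) ^ nat (aff_dim F) * f ((*\<^sub>R) (real k) ` uminus ` F))"
  define p where "p = interp (\<lambda>k. f ((*\<^sub>R) (real k) ` P))"
  note poly = poly_seq_dilate_uminus[OF f]
  have Fs: "F \<in> lpolys" if "F \<in> ?Fs" for F using that lpolys_face[OF P] by blast
  have poly_G: "poly_seq (m + CARD('n)) G"
    unfolding G_def using poly[OF Fs] by (intro poly_seq_sum poly_seq_cmult)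
  have p: "f ((*\<^sub>R) (real k) ` P) = poly p (real k)" for k
    unfolding p_def by (rule poly_seq_interp[OF poly_seq_dilate[OF f P]])
  \<comment> \<open>The correspondence between faces of \<open>P\<close> and faces of its dilate
    requires injectivity, hence k \<ge> 1; agreement there already determines the
    polynomial.\<close>
  have "G k = poly (pcompose p [:0, -1:]) (real k)" if "k \<ge> 1" for k
  proof -
    have lin: "linear (\<lambda>x. real k *\<^sub>R (- x :: real ^ 'n))" "inj (\<lambda>x. real k *\<^sub>R (- x :: real ^ 'n))"
      using that by (auto simp: inj_def intro!: linearI simp: algebra_simps)
    have "G k = face_sum f ((\<lambda>x. real k *\<^sub>R (- x)) ` P)"
      using face_sum_linear_image[OF lin, of f P] by (simp add: G_def image_image)
    also have "(\<lambda>x. real k *\<^sub>R (- x)) ` P = (*\<^sub>R) (- real k) ` P" by auto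
    also have "face_sum f \<dots> = dual_val f \<dots>"
      using P by (intro face_sum_eq_dual_val[OF f] lpolys_scale) auto
    \<comment> \<open>Both reflections cancel, leaving the sequence p(jk) in the new variable j; its
      value at j = -1 is p(-k).\<close>
    also have "\<dots> = at_neg1 (\<lambda>j. f ((*\<^sub>R) (real (j * k)) ` P))"
      by (simp add: dual_val_def image_image)
    also have "\<dots> = poly (pcompose p [:0, real k:]) (-1)"
      unfolding at_neg1_def
      by (subst interp_eqI[of _ "pcompose p [:0, real k:]"]) (auto simp only: p poly_pcompose, simp)
    finally show ?thesis by (simp add: poly_pcompose)
  qed
  then have "interp G = pcompose p [:0, -1:]"
    using poly_seq_interp[OF poly_G] by (intro poly_eq_if_eq_on_nat[of 1]) metis
  then have "at_neg1 G = f ((*\<^sub>R) (real 1) ` P)"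
    by (simp only: p at_neg1_def) (simp add: poly_pcompose)
  moreover have "at_neg1 G = (\<Sum>F\<in>?Fs. at_neg1 (\<lambda>k. (-1) ^ nat (aff_dim F) * f ((*\<^sub>R) (real k) ` uminus ` F)))"
    unfolding G_def using poly[OF Fs] by (intro at_neg1_sum poly_seq_cmult)
  moreover have "at_neg1 (\<lambda>k. (-1) ^ nat (aff_dim F) * f ((*\<^sub>R) (real k) ` uminus ` F)) = (-1) ^ nat (aff_dim F) * dual_val f F"
    if "F \<in> ?Fs" for F
    using interp_cmult[OF poly[OF Fs[OF that]] poly[OF Fs[OF that]]] by (simp add: at_neg1_def dual_val_def)
  ultimately show ?thesis by simp
qed

subsection \<open>The relative interior\<close>

lemma sum_signs_nonempty_subsets:
  assumes "finite X"
  shows "(\<Sum>J | J \<subseteq> X \<and> J \<noteq> {}. (-1) ^ (card J - 1)) = (if X = {} then 0 else 1 :: real)"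
proof (cases "X = {}")
  case False
  then obtain a Y where Y: "X = insert a Y" "a \<notin> Y" by (meson all_not_in_conv mk_disjoint_insert)
  have "(\<Sum>J\<in>Pow X. (-1) ^ card J) = (0 :: real)"
  proof -
    have "card (insert a S) = Suc (card S)" if "S \<in> Pow Y" for S
      using that Y assms finite_subset by (subst card_insert_disjoint) auto
    then show ?thesis
      unfolding Y(1) using Y assms by (subst sum_Pow_insert) (auto simp: sum_negf)
  qed
  then have "(\<Sum>J\<in>Pow X - {{}}. (-1) ^ card J) = (-1 :: real)"
    using assms by (simp add: sum_diff1)
  moreover have "(\<Sum>J\<in>Pow X - {{}}. (-1) ^ (card J - 1)) = - (\<Sum>J\<in>Pow X - {{}}. (-1) ^ card J :: real)"
    unfolding sum_negf[symmetric]
  proof (rule sum.cong)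
    fix J assume "J \<in> Pow X - {{}}"
    then have "card J > 0" using assms finite_subset by (auto simp: card_gt_0_iff)
    then show "(-1) ^ (card J - 1) = - ((-1) ^ card J :: real)" by (cases "card J") auto
  qed simp
  moreover have "{J. J \<subseteq> X \<and> J \<noteq> {}} = Pow X - {{}}" by auto
  ultimately show ?thesis using False by simp
qed auto

text \<open>After exchanging the sums, h(F) is weighted by the signed count of nonempty sets of
  proper faces that all contain \<open>F\<close>. This count is 1 if such a face exists and 0
  otherwise, and none exists exactly for F = P. The empty face is among the proper faces, so
  intersections may be empty and \<open>f {} = 0\<close> enters.\<close>

lemma alternating_sum_proper_faces:
  fixes P :: "(real ^ 'n::finite) set"
  assumes "polytope P" "P \<noteq> {}" "f {} = 0"
    and f: "\<And>F. F face_of P \<Longrightarrow> F \<noteq> {} \<Longrightarrow> f F = (\<Sum>G | G face_of F \<and> G \<noteq> {}. h G)"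
  shows "f P - (\<Sum>J | J \<subseteq> {F. F face_of P \<and> F \<noteq> P} \<and> J \<noteq> {}. (-1) ^ (card J - 1) * f (\<Inter>J)) = (h P :: real)"
proof -
  let ?Pr = "{F. F face_of P \<and> F \<noteq> P}"
  let ?Fs = "{F. F face_of P \<and> F \<noteq> {}}"
  let ?Js = "{J. J \<subseteq> ?Pr \<and> J \<noteq> {}}"
  have fin: "finite {F. F face_of P}" using assms(1) by (rule finite_polytope_faces)
  have finPr: "finite ?Pr" by (rule finite_subset[OF _ fin]) auto
  have finFs: "finite ?Fs" by (rule finite_subset[OF _ fin]) auto
  have finJ: "finite ?Js" by (rule finite_subset[of _ "Pow ?Pr"]) (use finPr in auto)
  have Inter: "f (\<Inter>J) = (\<Sum>F\<in>?Fs. if F \<subseteq> \<Inter>J then h F else 0)" if J: "J \<in> ?Js" for J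
  proof -
    have face: "\<Inter>J face_of P" using J by (intro face_of_Inter) auto
    have "{F \<in> ?Fs. F \<subseteq> \<Inter>J} = {G. G face_of \<Inter>J \<and> G \<noteq> {}}"
      using face face_of_trans[OF _ face] face_of_subset[OF _ _ face_of_imp_subset[OF face]] face_of_imp_subset
      by blast
    moreover have "(\<Sum>F\<in>?Fs. if F \<subseteq> \<Inter>J then h F else 0) = sum h {F \<in> ?Fs. F \<subseteq> \<Inter>J}"
      by (rule sum.inter_filter[OF finFs, symmetric])
    ultimately have "(\<Sum>F\<in>?Fs. if F \<subseteq> \<Inter>J then h F else 0) = (\<Sum>G | G face_of \<Inter>J \<and> G \<noteq> {}. h G)"
      by simp
    also have "\<dots> = f (\<Inter>J)"
    proof (cases "\<Inter>J = {}")
      case True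
      then have "{G. G face_of \<Inter>J \<and> G \<noteq> {}} = {}" using face_of_imp_subset by fastforce
      then show ?thesis using True assms(3) by simp
    qed (use f[OF face] in simp)
    finally show ?thesis by simp
  qed
  have "(\<Sum>J\<in>?Js. (-1) ^ (card J - 1) * f (\<Inter>J))
      = (\<Sum>J\<in>?Js. \<Sum>F\<in>?Fs. (if F \<subseteq> \<Inter>J then (-1) ^ (card J - 1) * h F else 0))"
    by (intro sum.cong refl) (simp only: Inter sum_distrib_left, intro sum.cong refl, simp)
  also have "\<dots> = (\<Sum>F\<in>?Fs. \<Sum>J\<in>?Js. (if F \<subseteq> \<Inter>J then (-1) ^ (card J - 1) * h F else 0))"
    by (rule sum.swap)
  also have "\<dots> = (\<Sum>F\<in>?Fs. (if F = P then 0 else h F))"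
  proof (rule sum.cong[OF refl])
    fix F assume F: "F \<in> ?Fs"
    let ?X = "{G \<in> ?Pr. F \<subseteq> G}"
    have finX: "finite ?X" by (rule finite_subset[OF _ finPr]) auto
    have "(\<Sum>J\<in>?Js. (if F \<subseteq> \<Inter>J then (-1) ^ (card J - 1) * h F else 0))
        = (\<Sum>J | J \<in> ?Js \<and> F \<subseteq> \<Inter>J. (-1) ^ (card J - 1) * h F)"
      using finJ by (simp only: sum.inter_filter)
    also have "{J. J \<in> ?Js \<and> F \<subseteq> \<Inter>J} = {J. J \<subseteq> ?X \<and> J \<noteq> {}}" by auto
    also have "(\<Sum>J | J \<subseteq> ?X \<and> J \<noteq> {}. (-1) ^ (card J - 1) * h F) = (if ?X = {} then 0 else 1) * h F"
      by (simp only: sum_signs_nonempty_subsets[OF finX, symmetric] sum_distrib_right)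
    also have "?X = {} \<longleftrightarrow> F = P"
      using F face_of_imp_subset by blast
    finally show "(\<Sum>J\<in>?Js. (if F \<subseteq> \<Inter>J then (-1) ^ (card J - 1) * h F else 0)) = (if F = P then 0 else h F)"
      by simp
  qed
  also have "\<dots> = (\<Sum>F\<in>?Fs. h F) - h P"
  proof -
    have "P \<in> ?Fs" using assms(1,2) by (simp add: face_of_refl polytope_imp_convex)
    then show ?thesis using finFs by (simp add: sum.remove[of ?Fs P])
  qed
  also have "(\<Sum>F\<in>?Fs. h F) = f P"
    using f[of P] assms(1,2) by (simp add: face_of_refl polytope_imp_convex)
  finally show ?thesis by simp
qed

subsection \<open>Polynomial functions on the lattice\<close>

text \<open>The counterpart of \<open>transl_poly\<close> for functions of the translation vector,
  where products can be handled.\<close>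

primrec lattice_poly :: "nat \<Rightarrow> (real ^ 'n::finite \<Rightarrow> real) \<Rightarrow> bool" where
  "lattice_poly 0 b \<longleftrightarrow> (\<forall>x\<in>int_lattice. b x = 0)"
| "lattice_poly (Suc m) b \<longleftrightarrow> (\<forall>y\<in>int_lattice. lattice_poly m (\<lambda>x. b (x + y) - b x))"

lemma lattice_poly_cong: "(\<And>x. x \<in> int_lattice \<Longrightarrow> b x = c x) \<Longrightarrow> lattice_poly m b \<longleftrightarrow> lattice_poly m c"
proof (induction m arbitrary: b c)
  case (Suc m)
  have "lattice_poly m (\<lambda>x. b (x + y) - b x) \<longleftrightarrow> lattice_poly m (\<lambda>x. c (x + y) - c x)"
    if "y \<in> int_lattice" for y
    using that by (intro Suc.IH) (simp add: Suc.prems int_lattice_add)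
  then show ?case by simp
qed simp

lemma lattice_poly_zero: "lattice_poly m (\<lambda>x. 0)"
  by (induction m) auto

lemma lattice_poly_add: "lattice_poly m b \<Longrightarrow> lattice_poly m c \<Longrightarrow> lattice_poly m (\<lambda>x. b x + c x)"
proof (induction m arbitrary: b c)
  case (Suc m)
  then have "lattice_poly m (\<lambda>x. (b (x + y) - b x) + (c (x + y) - c x))" if "y \<in> int_lattice" for y
    using that by auto
  then show ?case by (simp add: algebra_simps)
qed simp

lemma lattice_poly_cmult: "lattice_poly m b \<Longrightarrow> lattice_poly m (\<lambda>x. k * b x)"
proof (induction m arbitrary: b)
  case (Suc m)
  then have "lattice_poly m (\<lambda>x. k * (b (x + y) - b x))" if "y \<in> int_lattice" for y
    using that by auto
  then show ?case by (simp add: right_diff_distrib)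
qed simp

lemma lattice_poly_sum: "(\<And>i. i \<in> I \<Longrightarrow> lattice_poly m (b i)) \<Longrightarrow> lattice_poly m (\<lambda>x. \<Sum>i\<in>I. b i x)"
  by (induction I rule: infinite_finite_induct) (auto intro: lattice_poly_add lattice_poly_zero)

lemma lattice_poly_shift: "lattice_poly m b \<Longrightarrow> y \<in> int_lattice \<Longrightarrow> lattice_poly m (\<lambda>x. b (x + y))"
proof (induction m arbitrary: b)
  case (Suc m)
  then have "lattice_poly m (\<lambda>x. b (x + y + z) - b (x + y))" if "z \<in> int_lattice" for z
    using Suc.IH[of "\<lambda>x. b (x + z) - b x"] that by simp
  then show ?case by (simp add: add.commute add.left_commute)
qed (simp add: int_lattice_add)

lemma lattice_poly_Suc: "lattice_poly m b \<Longrightarrow> lattice_poly (Suc m) b"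
proof (induction m arbitrary: b)
  case 0
  then show ?case by (simp add: int_lattice_add)
next
  case (Suc m)
  then show ?case by (metis lattice_poly.simps(2))
qed

lemma lattice_poly_mono: "m \<le> k \<Longrightarrow> lattice_poly m b \<Longrightarrow> lattice_poly k b"
  by (induction k rule: dec_induct) (auto intro: lattice_poly_Suc simp del: lattice_poly.simps)

text \<open>A Leibniz rule for differences: the difference of the product is (x \<bullet> a) times
  the difference of \<open>b\<close>, covered by induction, plus the constant y \<bullet> a times a
  shift of \<open>b\<close>.\<close>

lemma lattice_poly_mult_inner: "lattice_poly m b \<Longrightarrow> lattice_poly (Suc m) (\<lambda>x. (x \<bullet> a) * b x)"
proof (induction m arbitrary: b)
  case 0
  then show ?case by (simp add: int_lattice_add)
next
  case (Suc m)
  have "lattice_poly (Suc m) (\<lambda>x. (x \<bullet> a) * (b (x + y) - b x) + (y \<bullet> a) * b (x + y))" if y: "y \<in> int_lattice" for y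
    using Suc.prems y
    by (intro lattice_poly_add Suc.IH lattice_poly_cmult lattice_poly_shift) auto
  moreover have "(\<lambda>x. (x \<bullet> a) * (b (x + y) - b x) + (y \<bullet> a) * b (x + y))
      = (\<lambda>x. ((x + y) \<bullet> a) * b (x + y) - (x \<bullet> a) * b x)" for y
    by (simp add: inner_add_left algebra_simps)
  ultimately show ?case by (subst lattice_poly.simps) (simp del: lattice_poly.simps)
qed

lemma lattice_poly_prod_inner: "lattice_poly (Suc j) (\<lambda>x. \<Prod>i<j. x \<bullet> a i)"
proof (induction j)
  case (Suc j)
  from lattice_poly_mult_inner[OF this, of "a j"] show ?case
    by (simp add: mult.commute del: lattice_poly.simps)
qed simp

lemma transl_polyI:
  "(\<And>P. P \<in> lpolys \<Longrightarrow> lattice_poly m (\<lambda>y. f ({y} + P))) \<Longrightarrow> transl_poly m f"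
proof (induction m arbitrary: f)
  case 0
  have "f P = 0" if "P \<in> lpolys" for P
    using 0[OF that] int_lattice_zero by (auto dest!: bspec[of _ _ 0])
  then show ?case by simp
next
  case (Suc m)
  have "transl_poly m (\<lambda>P. f ({y} + P) - f P)" if y: "y \<in> int_lattice" for y
  proof (rule Suc.IH)
    fix P :: "(real ^ 'a) set" assume "P \<in> lpolys"
    then have "lattice_poly m (\<lambda>x. f ({x + y} + P) - f ({x} + P))" using Suc.prems y by simp
    moreover have "{x + y} + P = {y} + ({x} + P)" for x
    proof -
      have "{x + y} = {y} + {x}" by (simp add: set_plus_def add.commute)
      then show ?thesis by (simp only: add.assoc)
    qed
    ultimately show "lattice_poly m (\<lambda>x. f ({y} + ({x} + P)) - f ({x} + P))" by simp
  qed
  then show ?case by simp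
qed

text \<open>With \<open>v\<close> fixed, the j-th term is a linear combination of products of j
  inner products with y, hence of degree at most j \<le> r in y.\<close>

lemma translation_covariant_imp_transl_poly:
  fixes Z :: "(real ^ 'n::finite) set \<Rightarrow> 'n tensor"
  assumes "translation_covariant r Z"
  shows "transl_poly (Suc r) (\<lambda>P. Z P v)"
proof (rule transl_polyI)
  fix P :: "(real ^ 'n) set" assume P: "P \<in> lpolys"
  obtain Z' where Z': "\<And>y v. y \<in> int_lattice \<Longrightarrow>
      Z ((\<lambda>x. x + y) ` P) v = (\<Sum>j\<le>r. sym_prod (r - j) j (Z' (r - j) P) (sym_power j y) v / fact j)"
    using assms P unfolding translation_covariant_def lattice_polytopes_eq by blast
  have "lattice_poly (Suc r) (\<lambda>y. sym_prod (r - j) j (Z' (r - j) P) (sym_power j y) v / fact j)" if "j \<le> r" for j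
  proof (rule lattice_poly_mono)
    have "lattice_poly (Suc j) (\<lambda>y. (1 / fact j / fact (r - j + j)) * (\<Sum>\<sigma> | \<sigma> permutes {..<r - j + j}.
        Z' (r - j) P (\<lambda>i. v (\<sigma> i)) * (\<Prod>i<j. y \<bullet> v (\<sigma> (r - j + i)))))"
      by (intro lattice_poly_cmult lattice_poly_sum lattice_poly_prod_inner)
    then show "lattice_poly (Suc j) (\<lambda>y. sym_prod (r - j) j (Z' (r - j) P) (sym_power j y) v / fact j)"
      by (simp add: sym_prod_def sym_power_def mult.commute del: lattice_poly.simps)
  qed (use that in simp)
  then have "lattice_poly (Suc r) (\<lambda>y. \<Sum>j\<le>r. sym_prod (r - j) j (Z' (r - j) P) (sym_power j y) v / fact j)"
    by (intro lattice_poly_sum) auto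
  then show "lattice_poly (Suc r) (\<lambda>y. Z ({y} + P) v)"
    using lattice_poly_cong[of "\<lambda>y. Z ({y} + P) v" _ "Suc r"] Z' by (simp add: translation_eq_plus del: lattice_poly.simps)
qed

subsection \<open>Homogeneous components\<close>

text \<open>The interpolating polynomial depends linearly on the sequence, so its coefficients
  inherit multilinearity and symmetry in \<open>v\<close> from the values of \<open>Z\<close>; this
  makes them an admissible witness. For uniqueness, polynomials agreeing on all naturals are
  compared, and the padding fixes the indices beyond n + r.\<close>

lemma homogeneous_component_eq:
  fixes Z :: "(real ^ 'n::finite) set \<Rightarrow> 'n tensor"
  assumes Z: "valuation r Z" and P: "P \<in> lattice_polytopes"
    and poly: "\<And>v. poly_seq (Suc r + CARD('n)) (\<lambda>k. Z ((*\<^sub>R) (real k) ` P) v)"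
  shows "homogeneous_component r Z i P v = coeff (interp (\<lambda>k. Z ((*\<^sub>R) (real k) ` P) v)) i"
proof -
  let ?F = "\<lambda>v k. Z ((*\<^sub>R) (real k) ` P) v"
  let ?N = "CARD('n) + r"
  define c where "c = (\<lambda>i v. coeff (interp (?F v)) i)"
  have kP: "(*\<^sub>R) (real k) ` P \<in> lattice_polytopes" for k
    using P lpolys_scale[of P "real k"] by (auto simp: lattice_polytopes_eq)
  have sym: "Z ((*\<^sub>R) (real k) ` P) \<in> sym_tensors r" for k
    using Z kP by (simp add: valuation_def)
  have c_sym: "c i \<in> sym_tensors r" for i
    unfolding sym_tensors_def
  proof (intro CollectI conjI allI impI)
    fix v w :: "nat \<Rightarrow> real ^ 'n" assume "\<forall>i<r. v i = w i"
    then have "?F v = ?F w" using sym unfolding sym_tensors_def by blast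
    then show "c i v = c i w" by (simp add: c_def)
  next
    fix j and v :: "nat \<Rightarrow> real ^ 'n" assume "j < r"
    then have lin: "linear (\<lambda>x. ?F (v(j := x)) k)" for k
      using sym unfolding sym_tensors_def by blast
    show "linear (\<lambda>x. c i (v(j := x)))"
    proof (rule linearI)
      fix x y :: "real ^ 'n" and a :: real
      have "?F (v(j := x + y)) = (\<lambda>k. ?F (v(j := x)) k + ?F (v(j := y)) k)"
        using linear_add[OF lin] by blast
      then show "c i (v(j := x + y)) = c i (v(j := x)) + c i (v(j := y))"
        using interp_add[OF poly poly] by (simp add: c_def)
      have "?F (v(j := a *\<^sub>R x)) = (\<lambda>k. a * ?F (v(j := x)) k)"
        using linear_scale[OF lin] by fastforce
      then show "c i (v(j := a *\<^sub>R x)) = a *\<^sub>R c i (v(j := x))"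
        using interp_cmult[OF poly poly] by (simp add: c_def)
    qed
  next
    fix \<sigma> and v :: "nat \<Rightarrow> real ^ 'n" assume "\<sigma> permutes {..<r}"
    then have "?F (\<lambda>i. v (\<sigma> i)) = ?F v" using sym unfolding sym_tensors_def by blast
    then show "c i (\<lambda>i. v (\<sigma> i)) = c i v" by (simp add: c_def)
  qed
  have c_high: "c i v = 0" if "i > ?N" for i v
    using poly_seq_coeff[OF poly] that by (simp add: c_def)
  have c_eq: "?F v k = (\<Sum>i\<le>?N. c i v * real k ^ i)" for k v
  proof -
    have "degree (interp (?F v)) \<le> ?N" using c_high by (intro degree_le) (simp add: c_def)
    from poly_eq_sum_coeff[OF this, of "real k"] show ?thesis using poly_seq_interp[OF poly[of v], of k] by (simp add: c_def)
  qed
  have "c' = c" if c': "\<forall>i > ?N. c' i = (\<lambda>v. 0)" "\<forall>(k::nat) v. ?F v k = (\<Sum>i\<le>?N. c' i v * real k ^ i)" for c'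
  proof (intro ext)
    fix i v
    have "interp (?F v) = (\<Sum>i\<le>?N. monom (c' i v) i)"
      by (rule interp_eqI) (simp add: poly_sum poly_monom c'(2))
    then have "c i v = (\<Sum>j\<le>?N. if j = i then c' j v else 0)" by (simp add: c_def coeff_sum)
    then show "c' i v = c i v" using c'(1) by (cases "i \<le> ?N") auto
  qed
  then have "(THE c. (\<forall>i. c i \<in> sym_tensors r) \<and> (\<forall>i > ?N. c i = (\<lambda>v. 0)) \<and>
      (\<forall>(k::nat) v. ?F v k = (\<Sum>i\<le>?N. c i v * real k ^ i))) = c"
    by (intro the_equality) (auto simp: c_sym c_high c_eq)
  then show ?thesis by (simp add: homogeneous_component_def c_def)
qed

theorem corollary19:
  fixes Z :: "(real ^ 'n::finite) set \<Rightarrow> 'n tensor" and r :: nat and P :: "(real ^ 'n) set"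
  assumes "CARD('n) \<ge> 2" and "r \<ge> 1"
    and "valuation r Z" and "translation_covariant r Z"
    and "P \<in> lattice_polytopes"
  shows "val_relint Z P =
    (\<lambda>v. (-1) powi aff_dim P *
      (\<Sum>i\<le>CARD('n) + r. (-1) ^ i * homogeneous_component r Z i (uminus ` P) v))"
proof
  fix v
  let ?f = "\<lambda>v P. Z P v"
  let ?F = "\<lambda>v k. Z ((*\<^sub>R) (real k) ` uminus ` P) v"
  have empty: "Z {} v = 0" for v using assms(3) by (simp add: valuation_def)
  have wv: "weak_val (?f v)" for v
    using assms(3) by (auto simp: valuation_def weak_val_def lattice_polytopes_eq)
  have tp: "transl_poly (Suc r) (?f v)" for v
    by (rule translation_covariant_imp_transl_poly[OF assms(4)])
  have minusP: "uminus ` P \<in> lattice_polytopes"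
    using assms(5) lpolys_uminus by (auto simp: lattice_polytopes_eq)
  have poly: "poly_seq (Suc r + CARD('n)) (?F v)" for v
  proof (cases "P = {}")
    case False
    then show ?thesis
      using assms(5) poly_seq_dilate_uminus[OF wv tp] by (auto simp: lattice_polytopes_eq)
  qed (simp add: empty poly_seq_zero)
  have "(\<Sum>i\<le>CARD('n) + r. (-1) ^ i * homogeneous_component r Z i (uminus ` P) v) = at_neg1 (?F v)"
  proof -
    have "degree (interp (?F v)) \<le> CARD('n) + r"
      using poly_seq_coeff[OF poly] by (intro degree_le) simp
    from poly_eq_sum_coeff[OF this, of "-1"]
    have "at_neg1 (?F v) = (\<Sum>i\<le>CARD('n) + r. coeff (interp (?F v)) i * (-1) ^ i)"
      unfolding at_neg1_def .
    then show ?thesis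
      by (simp add: homogeneous_component_eq[OF assms(3) minusP poly] mult.commute)
  qed
  moreover have "val_relint Z P v = (-1) powi aff_dim P * at_neg1 (?F v)"
  proof (cases "P = {}")
    \<comment> \<open>The empty polytope has no proper faces and all its dilates are empty, so both
      sides are zero whatever the sign for dimension -1.\<close>
    case True
    then show ?thesis
      by (simp add: val_relint_def val_Union_def empty at_neg1_def interp_zero)
  next
    case False
    then have P: "P \<in> lpolys" using assms(5) by (simp add: lattice_polytopes_eq)
    have "val_relint Z P v = (-1) ^ nat (aff_dim P) * dual_val (?f v) P"
      unfolding val_relint_def val_Union_def
      using lpolys_polytope[OF P] False empty
      by (rule alternating_sum_proper_faces) (simp add: face_sum_dual_val[OF wv tp lpolys_face[OF P]])
    moreover have "aff_dim P \<ge> 0"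
      using False aff_dim_geq[of P] aff_dim_empty[of P] by linarith
    ultimately show ?thesis by (simp add: dual_val_def power_int_def)
  qed
  ultimately show "val_relint Z P v = (-1) powi aff_dim P *
      (\<Sum>i\<le>CARD('n) + r. (-1) ^ i * homogeneous_component r Z i (uminus ` P) v)" by simp
qed

end
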